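(* Let $(\mathcal X,g^{\mathcal X})$ and $(\mathcal V,g^{\mathcal V})$ be Riemannian manifolds, let $\psi:\mathcal X\to\mathbb R^+$ be a smooth positive function, and let $\mathcal M=\mathcal X\times_\psi\mathcal V$ be the warped product, with projections $\pi_{\mathcal X}:\mathcal M\to\mathcal X$ and $\pi_{\mathcal V}:\mathcal M\to\mathcal V$. Let $\varphi:M\to\mathcal M$ be an isometric immersion of a Riemannian manifold $(M,g^M)$, let $(h,\Gamma)$ be an OY-pair for the Hessian in $(\mathcal V,g^{\mathcal V})$, and set $\gamma=\Gamma\circ\pi_{\mathcal V}\circ\varphi:M\to[0,+\infty)$. Assume that: (a) $\varphi$ is proper; (b) $\pi_{\mathcal X}(\varphi(M))$ is contained in a compact subset $K$ of $\mathcal X$. Then: (i) if (c) there is $\alpha>0$ such that, outside a compact subset of $M$, $\|\mathcal S^\varphi\|\le\alpha\sqrt{h(\sqrt\gamma)}$, then $(h,\gamma)$ is an OY-pair for the Hessian in $(M,g^M)$; (ii) if (c') there is $\alpha>0$ such that, outside a compact subset of $M$, $|\vec H^\varphi|\le\alpha\sqrt{h(\sqrt\gamma)}$, then $(h,\gamma)$ is an OY-pair for the Laplacian in $(M,g^M)$.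
   Context: The warped product $\mathcal X\times_\psi\mathcal V$ is the product manifold $\mathcal X\times\mathcal V$ with the metric $g^{\mathcal X}+\psi^2 g^{\mathcal V}$, where $\psi$ is evaluated at the $\mathcal X$-component. $\mathcal S^\varphi$ is the second fundamental form of $\varphi$; the inequality $\|\mathcal S^\varphi\|\le\alpha\sqrt{h(\sqrt\gamma)}$ means $\|\mathcal S^\varphi(e,e)\|_{\mathcal M}\le\alpha\sqrt{h(\sqrt\gamma)}\,|e|_M^2$ for all $e\in TM$ (at the points considered). The mean curvature vector $\vec H^\varphi$ is the (unnormalized) trace of $\mathcal S^\varphi$. For a Riemannian manifold $(N,g^N)$, a pair of smooth functions $h:[0,+\infty)\to[0,+\infty)$ and $\gamma:N\to[0,+\infty)$ is an OY-pair for the Hessian in $(N,g^N)$ if: (1) $h(0)>0$ and $h'(t)\ge0$ for all $t\ge0$; (2) $\limsup_{t\to+\infty}\, t\,h(\sqrt t)/h(t)<+\infty$; (3) $\int_0^{+\infty}dt/\sqrt{h(t)}=+\infty$; (4) $\gamma$ is proper; (5) $|\mathrm{grad}^N\gamma|\le c\sqrt\gamma$ for some $c>0$ outside a compact subset of $N$; (6) $\mathrm{Hess}^N\gamma\le c'\sqrt{\gamma\, h(\sqrt\gamma)}$ for some $c'>0$ outside a compact subset of $N$, i.e. $\mathrm{Hess}^N\gamma(e,e)\le c'\sqrt{\gamma\, h(\sqrt\gamma)}\,g^N(e,e)$ for all tangent vectors $e$ there. It is an OY-pair for the Laplacian if (1)--(5) hold together with (6'): $\Delta^N\gamma\le c'\sqrt{\gamma\,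 h(\sqrt\gamma)}$ for some $c'>0$ outside a compact subset of $N$. *)

theory Defs
  imports "HOL-Analysis.Analysis"
begin

text \<open>
  Riemannian manifolds are given by an indexed smooth atlas together with the components of the
  metric in each chart. Charts take values in a finite-dimensional inner product space \<open>'e\<close>; the
  sort \<open>real_inner\<close> (with finite dimension required in the definition of a manifold) is used
  rather than \<open>euclidean_space\<close> so that dimension 0 is not excluded. The inner product of \<open>'e\<close> is
  only an auxiliary structure and plays no role in the geometry.

  A tangent vector at \<open>p\<close> is represented by a pair of a chart around \<open>p\<close> and a component vector in
  that chart. Gradients, Hessians, second fundamental forms etc. are written in components;
  they are tensorial, so that quantifying over all charts around \<open>p\<close> and all component vectors
  is quantifying over all tangent vectors at \<open>p\<close>.
\<close>


section \<open>Smooth functions\<close>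

text \<open>
  For open \<open>S\<close> the derivative within \<open>S\<close> is the usual one. The relative version is used for
  functions on the closed half line \<open>{0..}\<close>, where the derivatives at 0 are one-sided.
\<close>

primrec Ck_on :: "nat \<Rightarrow> 'a::real_normed_vector set \<Rightarrow> ('a \<Rightarrow> 'b::real_normed_vector) \<Rightarrow> bool" where
  "Ck_on 0 S f \<longleftrightarrow> continuous_on S f"
| "Ck_on (Suc k) S f \<longleftrightarrow> f differentiable_on S \<and>
     (\<forall>v. Ck_on k S (\<lambda>x. frechet_derivative f (at x within S) v))"

definition smooth_on :: "'a::real_normed_vector set \<Rightarrow> ('a \<Rightarrow> 'b::real_normed_vector) \<Rightarrow> bool" where
  "smooth_on S f \<longleftrightarrow> (\<forall>k. Ck_on k S f)"


section \<open>Riemannian geometry in a coordinate domain\<close>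

type_synonym 'e local_metric = "'e \<Rightarrow> 'e \<Rightarrow> 'e \<Rightarrow> real"

abbreviation deriv_at :: "('a::real_normed_vector \<Rightarrow> 'b::real_normed_vector) \<Rightarrow> 'a \<Rightarrow> 'a \<Rightarrow> 'b" where
  "deriv_at f x v \<equiv> frechet_derivative f (at x) v"

text \<open>
  Christoffel symbols, \<open>christoffel g x u v = \<nabla>\<^sub>u v\<close> for constant coordinate vector fields
  \<open>u\<close>, \<open>v\<close>, where \<open>\<nabla>\<close> is the Levi-Civita connection (Koszul formula for commuting fields).
\<close>

definition christoffel :: "('e::real_inner) local_metric \<Rightarrow> 'e \<Rightarrow> 'e \<Rightarrow> 'e \<Rightarrow> 'e" where
  "christoffel g x u v = (THE z. \<forall>w. g x z w =
     (deriv_at (\<lambda>y. g y v w) x u + deriv_at (\<lambda>y. g y u w) x v - deriv_at (\<lambda>y. g y u v) x w) / 2)"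

definition local_norm :: "('e::real_inner) local_metric \<Rightarrow> 'e \<Rightarrow> 'e \<Rightarrow> real" where
  "local_norm g x u = sqrt (g x u u)"

definition local_grad :: "('e::real_inner) local_metric \<Rightarrow> ('e \<Rightarrow> real) \<Rightarrow> 'e \<Rightarrow> 'e" where
  "local_grad g f x = (THE z. \<forall>w. g x z w = deriv_at f x w)"

text \<open>\<open>Hess f (u, v) = u (v f) - (\<nabla>\<^sub>u v) f\<close> with constant coordinate fields \<open>u\<close>, \<open>v\<close>.\<close>

definition local_hess :: "('e::real_inner) local_metric \<Rightarrow> ('e \<Rightarrow> real) \<Rightarrow> 'e \<Rightarrow> 'e \<Rightarrow> 'e \<Rightarrow> real" where
  "local_hess g f x u v =
     deriv_at (\<lambda>y. deriv_at f y v) x u - deriv_at f x (christoffel g x u v)"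

definition orthonormal_basis :: "('e::real_inner \<Rightarrow> 'e \<Rightarrow> real) \<Rightarrow> 'e set \<Rightarrow> bool" where
  "orthonormal_basis b E \<longleftrightarrow> finite E \<and> span E = UNIV \<and>
     (\<forall>e\<in>E. \<forall>e'\<in>E. b e e' = (if e = e' then 1 else 0))"

text \<open>The trace of a (possibly vector-valued) bilinear form with respect to an inner product \<open>b\<close>;
  it does not depend on the orthonormal basis.\<close>

definition metric_trace ::
  "('e::real_inner \<Rightarrow> 'e \<Rightarrow> real) \<Rightarrow> ('e \<Rightarrow> 'e \<Rightarrow> 'b::real_vector) \<Rightarrow> 'b" where
  "metric_trace b B = (\<Sum>e\<in>(SOME E. orthonormal_basis b E). B e e)"

definition local_laplacian :: "('e::real_inner) local_metric \<Rightarrow> ('e \<Rightarrow> real) \<Rightarrow> 'e \<Rightarrow> real" where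
  "local_laplacian g f x = metric_trace (g x) (local_hess g f x)"

text \<open>
  For a map \<open>F\<close> into a coordinate domain with metric \<open>g\<close>, the covariant derivative in direction
  \<open>u\<close> of the vector field \<open>dF(v)\<close> along \<open>F\<close>, with \<open>v\<close> a constant coordinate field on the source.
\<close>

definition local_cov_deriv ::
  "('f::real_inner) local_metric \<Rightarrow> ('e::real_inner \<Rightarrow> 'f) \<Rightarrow> 'e \<Rightarrow> 'e \<Rightarrow> 'e \<Rightarrow> 'f" where
  "local_cov_deriv g F x u v =
     deriv_at (\<lambda>y. deriv_at F y v) x u + christoffel g (F x) (deriv_at F x u) (deriv_at F x v)"

text \<open>The second fundamental form is the normal component of the ambient covariant derivative.\<close>

definition local_sff ::
  "('f::real_inner) local_metric \<Rightarrow> ('e::real_inner \<Rightarrow> 'f) \<Rightarrow> 'e \<Rightarrow> 'e \<Rightarrow> 'e \<Rightarrow> 'f" where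
  "local_sff g F x u v = (THE n. (\<forall>w. g (F x) n (deriv_at F x w) = 0) \<and>
     local_cov_deriv g F x u v - n \<in> range (deriv_at F x))"


section \<open>Riemannian manifolds\<close>

text \<open>\<open>gcomp N i x u v\<close> is the metric in the chart \<open>i\<close> at the point with coordinates \<open>x\<close>,
  evaluated on the vectors with components \<open>u\<close> and \<open>v\<close>.\<close>

record ('a, 'i, 'e) riem =
  points :: "'a topology"
  index :: "'i set"
  cdom :: "'i \<Rightarrow> 'a set"
  coord :: "'i \<Rightarrow> 'a \<Rightarrow> 'e"
  gcomp :: "'i \<Rightarrow> 'e local_metric"

definition carr :: "('a, 'i, 'e) riem \<Rightarrow> 'a set" where
  "carr N = topspace (points N)"

definition charts_at :: "('a, 'i, 'e) riem \<Rightarrow> 'a \<Rightarrow> 'i set" where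
  "charts_at N p = {i \<in> index N. p \<in> cdom N i}"

definition chart_inv :: "('a, 'i, 'e) riem \<Rightarrow> 'i \<Rightarrow> 'e \<Rightarrow> 'a" where
  "chart_inv N i = inv_into (cdom N i) (coord N i)"

definition smooth_atlas :: "('a, 'i, 'e::real_inner) riem \<Rightarrow> bool" where
  "smooth_atlas N \<longleftrightarrow>
     Hausdorff_space (points N) \<and> second_countable (points N) \<and>
     (\<exists>B :: 'e set. finite B \<and> span B = UNIV) \<and>
     (\<Union>i\<in>index N. cdom N i) = carr N \<and>
     (\<forall>i\<in>index N. openin (points N) (cdom N i) \<and> open (coord N i ` cdom N i) \<and>
        homeomorphic_map (subtopology (points N) (cdom N i))
          (top_of_set (coord N i ` cdom N i)) (coord N i)) \<and>
     (\<forall>i\<in>index N. \<forall>j\<in>index N.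
        smooth_on (coord N i ` (cdom N i \<inter> cdom N j)) (coord N j \<circ> chart_inv N i))"

definition riemannian_metric :: "('a, 'i, 'e::real_inner) riem \<Rightarrow> bool" where
  "riemannian_metric N \<longleftrightarrow>
     (\<forall>i\<in>index N.
        (\<forall>x \<in> coord N i ` cdom N i.
           (\<forall>u. linear (gcomp N i x u)) \<and>
           (\<forall>u v. gcomp N i x u v = gcomp N i x v u) \<and>
           (\<forall>u. u \<noteq> 0 \<longrightarrow> gcomp N i x u u > 0)) \<and>
        (\<forall>u v. smooth_on (coord N i ` cdom N i) (\<lambda>x. gcomp N i x u v))) \<and>
     (\<forall>i\<in>index N. \<forall>j\<in>index N. \<forall>p \<in> cdom N i \<inter> cdom N j. \<forall>u v.
        (let T = deriv_at (coord N j \<circ> chart_inv N i) (coord N i p)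
         in gcomp N j (coord N j p) (T u) (T v) = gcomp N i (coord N i p) u v))"

definition riemannian_manifold :: "('a, 'i, 'e::real_inner) riem \<Rightarrow> bool" where
  "riemannian_manifold N \<longleftrightarrow> smooth_atlas N \<and> riemannian_metric N"

text \<open>The product atlas consists of the products of the charts of the factors.\<close>

definition warped_product ::
  "('a, 'i, 'e::real_inner) riem \<Rightarrow> ('a \<Rightarrow> real) \<Rightarrow> ('b, 'j, 'f::real_inner) riem
     \<Rightarrow> ('a \<times> 'b, 'i \<times> 'j, 'e \<times> 'f) riem" where
  "warped_product X \<psi> V =
     \<lparr> points = prod_topology (points X) (points V),
       index = index X \<times> index V,
       cdom = (\<lambda>(i, j). cdom X i \<times> cdom V j),
       coord = (\<lambda>(i, j) (p, q). (coord X i p, coord V j q)),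
       gcomp = (\<lambda>(i, j) (x, y) (u1, u2) (v1, v2).
         gcomp X i x u1 v1 + (\<psi> (chart_inv X i x))\<^sup>2 * gcomp V j y u2 v2) \<rparr>"

definition outside_compact :: "('a, 'i, 'e) riem \<Rightarrow> ('a \<Rightarrow> bool) \<Rightarrow> bool" where
  "outside_compact N P \<longleftrightarrow> (\<exists>C. compactin (points N) C \<and> (\<forall>p \<in> carr N - C. P p))"


section \<open>Functions and maps on manifolds\<close>

definition smooth_function :: "('a, 'i, 'e::real_inner) riem \<Rightarrow> ('a \<Rightarrow> real) \<Rightarrow> bool" where
  "smooth_function N f \<longleftrightarrow>
     (\<forall>i\<in>index N. smooth_on (coord N i ` cdom N i) (f \<circ> chart_inv N i))"

text \<open>In the following, \<open>i\<close> is a chart of the manifold around \<open>p\<close>, and \<open>u\<close>, \<open>v\<close> are components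
  of tangent vectors in this chart.\<close>

definition tnorm :: "('a, 'i, 'e::real_inner) riem \<Rightarrow> 'a \<Rightarrow> 'i \<Rightarrow> 'e \<Rightarrow> real" where
  "tnorm N p i u = local_norm (gcomp N i) (coord N i p) u"

definition grad :: "('a, 'i, 'e::real_inner) riem \<Rightarrow> ('a \<Rightarrow> real) \<Rightarrow> 'a \<Rightarrow> 'i \<Rightarrow> 'e" where
  "grad N f p i = local_grad (gcomp N i) (f \<circ> chart_inv N i) (coord N i p)"

definition hess :: "('a, 'i, 'e::real_inner) riem \<Rightarrow> ('a \<Rightarrow> real) \<Rightarrow> 'a \<Rightarrow> 'i \<Rightarrow> 'e \<Rightarrow> 'e \<Rightarrow> real" where
  "hess N f p i u v = local_hess (gcomp N i) (f \<circ> chart_inv N i) (coord N i p) u v"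

definition laplacian :: "('a, 'i, 'e::real_inner) riem \<Rightarrow> ('a \<Rightarrow> real) \<Rightarrow> 'a \<Rightarrow> 'i \<Rightarrow> real" where
  "laplacian N f p i = local_laplacian (gcomp N i) (f \<circ> chart_inv N i) (coord N i p)"

definition local_expr ::
  "('a, 'i, 'e) riem \<Rightarrow> ('b, 'j, 'f) riem \<Rightarrow> ('a \<Rightarrow> 'b) \<Rightarrow> 'i \<Rightarrow> 'j \<Rightarrow> 'e \<Rightarrow> 'f" where
  "local_expr M N \<phi> i j = coord N j \<circ> \<phi> \<circ> chart_inv M i"

definition smooth_map ::
  "('a, 'i, 'e::real_inner) riem \<Rightarrow> ('b, 'j, 'f::real_inner) riem \<Rightarrow> ('a \<Rightarrow> 'b) \<Rightarrow> bool" where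
  "smooth_map M N \<phi> \<longleftrightarrow> continuous_map (points M) (points N) \<phi> \<and>
     (\<forall>i\<in>index M. \<forall>j\<in>index N.
        smooth_on (coord M i ` {p \<in> cdom M i. \<phi> p \<in> cdom N j}) (local_expr M N \<phi> i j))"

text \<open>Components, in the chart \<open>j\<close> around \<open>\<phi> p\<close>, of the image under \<open>d\<phi>\<close> of the vector at \<open>p\<close>
  with components \<open>u\<close> in the chart \<open>i\<close>.\<close>

definition differential ::
  "('a, 'i, 'e::real_inner) riem \<Rightarrow> ('b, 'j, 'f::real_inner) riem \<Rightarrow> ('a \<Rightarrow> 'b)
     \<Rightarrow> 'a \<Rightarrow> 'i \<Rightarrow> 'j \<Rightarrow> 'e \<Rightarrow> 'f" where
  "differential M N \<phi> p i j u = deriv_at (local_expr M N \<phi> i j) (coord M i p) u"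

definition isometric_immersion ::
  "('a, 'i, 'e::real_inner) riem \<Rightarrow> ('b, 'j, 'f::real_inner) riem \<Rightarrow> ('a \<Rightarrow> 'b) \<Rightarrow> bool" where
  "isometric_immersion M N \<phi> \<longleftrightarrow> smooth_map M N \<phi> \<and>
     (\<forall>p \<in> carr M. \<forall>i \<in> charts_at M p. \<forall>j \<in> charts_at N (\<phi> p).
        inj (differential M N \<phi> p i j) \<and>
        (\<forall>u v. gcomp N j (coord N j (\<phi> p)) (differential M N \<phi> p i j u) (differential M N \<phi> p i j v)
             = gcomp M i (coord M i p) u v))"

definition second_fundamental_form ::
  "('a, 'i, 'e::real_inner) riem \<Rightarrow> ('b, 'j, 'f::real_inner) riem \<Rightarrow> ('a \<Rightarrow> 'b)
     \<Rightarrow> 'a \<Rightarrow> 'i \<Rightarrow> 'j \<Rightarrow> 'e \<Rightarrow> 'e \<Rightarrow> 'f" where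
  "second_fundamental_form M N \<phi> p i j u v =
     local_sff (gcomp N j) (local_expr M N \<phi> i j) (coord M i p) u v"

definition mean_curvature_vector ::
  "('a, 'i, 'e::real_inner) riem \<Rightarrow> ('b, 'j, 'f::real_inner) riem \<Rightarrow> ('a \<Rightarrow> 'b)
     \<Rightarrow> 'a \<Rightarrow> 'i \<Rightarrow> 'j \<Rightarrow> 'f" where
  "mean_curvature_vector M N \<phi> p i j =
     metric_trace (gcomp M i (coord M i p)) (second_fundamental_form M N \<phi> p i j)"


section \<open>OY-pairs\<close>

text \<open>The requirements shared by OY-pairs for the Hessian and for the Laplacian.\<close>

definition OY_common :: "('a, 'i, 'e::real_inner) riem \<Rightarrow> (real \<Rightarrow> real) \<Rightarrow> ('a \<Rightarrow> real) \<Rightarrow> bool" where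
  "OY_common N h \<gamma> \<longleftrightarrow>
     smooth_on {0..} h \<and> (\<forall>t\<ge>0. h t \<ge> 0) \<and>
     smooth_function N \<gamma> \<and> (\<forall>p \<in> carr N. \<gamma> p \<ge> 0) \<and>
     h 0 > 0 \<and> (\<forall>t\<ge>0. vector_derivative h (at t within {0..}) \<ge> 0) \<and>
     Limsup at_top (\<lambda>t. ereal (t * h (sqrt t) / h t)) < \<infinity> \<and>
     (\<integral>\<^sup>+ t\<in>{0..}. ennreal (1 / sqrt (h t)) \<partial>lborel) = \<infinity> \<and>
     proper_map (points N) (top_of_set {0..}) \<gamma> \<and>
     (\<exists>c>0. outside_compact N (\<lambda>p. \<forall>i \<in> charts_at N p.
        tnorm N p i (grad N \<gamma> p i) \<le> c * sqrt (\<gamma> p)))"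

definition OY_pair_hessian :: "('a, 'i, 'e::real_inner) riem \<Rightarrow> (real \<Rightarrow> real) \<Rightarrow> ('a \<Rightarrow> real) \<Rightarrow> bool" where
  "OY_pair_hessian N h \<gamma> \<longleftrightarrow> OY_common N h \<gamma> \<and>
     (\<exists>c>0. outside_compact N (\<lambda>p. \<forall>i \<in> charts_at N p. \<forall>e.
        hess N \<gamma> p i e e \<le> c * sqrt (\<gamma> p * h (sqrt (\<gamma> p))) * gcomp N i (coord N i p) e e))"

definition OY_pair_laplacian :: "('a, 'i, 'e::real_inner) riem \<Rightarrow> (real \<Rightarrow> real) \<Rightarrow> ('a \<Rightarrow> real) \<Rightarrow> bool" where
  "OY_pair_laplacian N h \<gamma> \<longleftrightarrow> OY_common N h \<gamma> \<and>
     (\<exists>c>0. outside_compact N (\<lambda>p. \<forall>i \<in> charts_at N p.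
        laplacian N \<gamma> p i \<le> c * sqrt (\<gamma> p * h (sqrt (\<gamma> p)))))"

end

theory Submission
  imports Defs
begin

text \<open>
  Write \<open>\<phi> = (\<phi>\<^sub>1, \<phi>\<^sub>2)\<close>. By the Gauss formula and the Koszul formula of the warped metric,
  \<open>Hess \<gamma> (e, e) = Hess \<Gamma> (d\<phi>\<^sub>2 e, d\<phi>\<^sub>2 e) + d\<Gamma> (S (e, e)) - 2 d\<psi> (d\<phi>\<^sub>1 e) / \<psi> * d\<Gamma> (d\<phi>\<^sub>2 e)\<close>.
  As \<open>\<phi>\<^sub>1\<close> takes values in a compact set, \<open>1 / \<psi>\<close> and \<open>d\<psi>\<close> are bounded there, and the last term
  is at most a multiple of \<open>\<surd>\<gamma> \<bar>e\<bar>\<^sup>2\<close>; this is absorbed by \<open>\<surd>(\<gamma> h(\<surd>\<gamma>))\<close>, since \<open>h \<ge> h(0) > 0\<close>. The term with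
  \<open>S\<close> is bounded by \<open>\<surd>\<gamma> \<bar>S(e, e)\<bar>\<close>, and becomes \<open>d\<Gamma> (H)\<close> on taking traces, so that the two
  curvature hypotheses give the two conclusions. Since \<open>\<phi>\<close> is proper, the complement of a compact
  subset of \<open>V\<close> pulls back to the complement of a compact subset of \<open>M\<close>.
\<close>


section \<open>Inner products on finite-dimensional spaces\<close>

text \<open>Gradients on \<open>M\<close> and \<open>V\<close> are never compared directly. A bound
  on the norm of a gradient amounts to a bound on the derivative by a multiple of the length of the
  direction, so the gradient condition passes to \<open>M\<close> through the chain rule. The same
  bound treats the curvature terms, at the price of a factor 1 / \<psi>, because a vertical vector
  is \<psi> times as long in the warped metric as in \<open>V\<close>.

  The obstacle is that connections, gradients and normal parts are definite descriptions and traces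
  use a chosen basis, over chart spaces whose finite dimension is a hypothesis. Orthonormal bases
  for arbitrary inner products answer both points: they produce the representing vectors, and they
  reduce families of linear maps to finitely many ordinary functions, so that no operator-valued
  derivative is needed. As the Hessian is bounded on pairs (e, e), the Koszul and Gauss formulas are
  stated on the diagonal.\<close>

locale inner_form =
  fixes b :: "'a::real_inner \<Rightarrow> 'a \<Rightarrow> real"
  assumes linear_right: "linear (b u)"
    and sym: "b u v = b v u"
    and pos: "u \<noteq> 0 \<Longrightarrow> b u u > 0"
    and finite_dim: "\<exists>B :: 'a set. finite B \<and> span B = UNIV"
begin

lemma linear_left: "linear (\<lambda>u. b u v)"
  using linear_right[of v] by (simp add: sym[of _ v])

lemma zero_right [simp]: "b u 0 = 0"
  by (simp add: linear_0 linear_right)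

lemma zero_left [simp]: "b 0 v = 0"
  using zero_right[of v] by (simp add: sym[of _ v])

lemma add_right: "b u (v + w) = b u v + b u w"
  by (simp add: linear_add linear_right)

lemma add_left: "b (u + v) w = b u w + b v w"
  using add_right[of w u v] by (simp add: sym[of w])

lemma diff_right: "b u (v - w) = b u v - b u w"
  by (simp add: linear_diff linear_right)

lemma diff_left: "b (u - v) w = b u w - b v w"
  using diff_right[of w u v] by (simp add: sym[of w])

lemma scale_right: "b u (r *\<^sub>R v) = r * b u v"
  using linear_right[of u] by (simp add: linear_cmul)

lemma scale_left: "b (r *\<^sub>R u) v = r * b u v"
  using scale_right[of v r u] by (simp add: sym[of v])

lemma sum_right: "b u (sum f A) = (\<Sum>i\<in>A. b u (f i))"
  by (simp add: linear_sum linear_right)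

lemma sum_left: "b (sum f A) v = (\<Sum>i\<in>A. b (f i) v)"
  using sum_right[of v f A] by (simp add: sym[of v])

lemma nonneg [simp]: "b u u \<ge> 0"
  using pos[of u] by (cases "u = 0") auto

lemma eq_zero_iff: "b u u = 0 \<longleftrightarrow> u = 0"
  using pos[of u] by (cases "u = 0") auto

lemma eqI:
  assumes "\<And>w. b u w = b v w"
  shows "u = v"
  using assms[of "u - v"] eq_zero_iff[of "u - v"] by (simp add: diff_left)

text \<open>Gram-Schmidt along the insertions that build \<open>B\<close>. A vector already in the
  span is discarded, so \<open>B\<close> may be any finite set and not only an independent
  one.\<close>

lemma orthonormal_span:
  assumes "finite B"
  shows "\<exists>E. finite E \<and> span E = span B \<and> (\<forall>e\<in>E. \<forall>e'\<in>E. b e e' = (if e = e' then 1 else 0))"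
  using assms
proof (induction B rule: finite_induct)
  case empty
  then show ?case by (intro exI[of _ "{}"]) auto
next
  case (insert x B)
  then obtain E where E: "finite E" "span E = span B"
    "\<And>e e'. e \<in> E \<Longrightarrow> e' \<in> E \<Longrightarrow> b e e' = (if e = e' then 1 else 0)"
    by blast
  have span_ins: "span (insert x B) = span (insert x E)"
    by (simp add: span_insert E(2))
  show ?case
  proof (cases "x \<in> span E")
    case True
    then show ?thesis
      using E span_ins by (intro exI[of _ E]) (simp add: span_redundant)
  next
    case False
    \<comment> \<open>\<open>p\<close> is the orthogonal projection of \<open>x\<close> onto
      \<open>span E\<close>. The remainder is nonzero because \<open>x\<close> lies outside the
      span, and \<open>n\<close> is its normalization.\<close>
    define p where "p = (\<Sum>e\<in>E. b x e *\<^sub>R e)"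
    define r where "r = sqrt (b (x - p) (x - p))"
    define n where "n = (1 / r) *\<^sub>R (x - p)"
    have p: "p \<in> span E"
      unfolding p_def by (intro span_sum span_scale span_base)
    have "x - p \<noteq> 0" using False p by auto
    then have r: "r > 0" unfolding r_def using pos by simp
    have nn: "b n n = 1"
      using r by (simp add: n_def scale_left scale_right r_def)
    have ne: "b n e = 0" if "e \<in> E" for e
    proof -
      have "b p e = (\<Sum>e'\<in>E. b x e' * (if e' = e then 1 else 0))"
        unfolding p_def sum_left scale_left using E(3) that by (intro sum.cong) auto
      also have "\<dots> = b x e" using E(1) that by (simp add: if_distrib cong: if_cong)
      finally show ?thesis by (simp add: n_def scale_left diff_left)
    qed
    have n_span: "n \<in> span (insert x E)"
      using p unfolding n_def
      by (meson span_base insertI1 span_diff span_mono span_scale subsetD subset_insertI)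
    have "x = r *\<^sub>R n + p" using r by (simp add: n_def)
    then have x_span: "x \<in> span (insert n E)"
      using p by (metis span_base insertI1 span_add span_mono span_scale subsetD subset_insertI)
    have "span (insert n E) = span (insert x E)"
      using n_span x_span by (intro span_eq[THEN iffD2])
        (auto intro: span_base)
    moreover have "b e e' = (if e = e' then 1 else 0)" if "e \<in> insert n E" "e' \<in> insert n E" for e e'
      using that E(3) ne nn sym by fastforce
    ultimately show ?thesis
      using E(1) span_ins by (intro exI[of _ "insert n E"]) auto
  qed
qed

lemma orthonormal_basis_exists: "\<exists>E. orthonormal_basis b E"
  using finite_dim orthonormal_span unfolding orthonormal_basis_def by metis

context
  fixes E
  assumes E: "orthonormal_basis b E"
begin

lemma finite_orthonormal_basis: "finite E"
  using E by (simp add: orthonormal_basis_def)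

lemma orthonormal: "e \<in> E \<Longrightarrow> e' \<in> E \<Longrightarrow> b e e' = (if e = e' then 1 else 0)"
  using E by (simp add: orthonormal_basis_def)

lemma orthonormal_expansion: "(\<Sum>e\<in>E. b u e *\<^sub>R e) = u"
proof -
  have "u \<in> span E" using E by (simp add: orthonormal_basis_def)
  then show ?thesis
  proof (induction rule: span_induct_alt)
    case base
    then show ?case by simp
  next
    case (step c x y)
    have "(\<Sum>e\<in>E. b x e *\<^sub>R e) = (\<Sum>e\<in>E. if x = e then e else 0)"
      using step(1) orthonormal by (intro sum.cong) auto
    also have "\<dots> = x" using step(1) finite_orthonormal_basis by simp
    finally have "(\<Sum>e\<in>E. b x e *\<^sub>R e) = x" .
    then show ?case using step(2)
      by (simp add: add_left scale_left scaleR_add_left sum.distrib flip: scaleR_scaleR scaleR_sum_right)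
  qed
qed

text \<open>Finitely many values determine a linear map. Derivatives of families of linear maps are
  later computed through this sum, one term for each basis vector.\<close>

lemma linear_expansion:
  assumes "linear f"
  shows "f u = (\<Sum>e\<in>E. b u e *\<^sub>R f e)"
proof -
  have "f u = f (\<Sum>e\<in>E. b u e *\<^sub>R e)" by (simp add: orthonormal_expansion)
  also have "\<dots> = (\<Sum>e\<in>E. b u e *\<^sub>R f e)"
    using assms by (simp add: linear_sum linear_cmul)
  finally show ?thesis .
qed

lemma norm_expansion: "b u u = (\<Sum>e\<in>E. (b u e)\<^sup>2)"
  using linear_expansion[OF linear_right, of u u] by (simp add: power2_eq_square)

text \<open>Orthonormality implies independence. Hence the trace of the metric itself is the
  dimension, whichever basis the choice in \<open>metric_trace\<close> returns.\<close>

lemma card_orthonormal_basis: "card E = dim (UNIV :: 'a set)"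
proof -
  have "independent E"
    unfolding independent_explicit_finite_subsets
  proof (intro allI impI ballI)
    fix A u v
    assume A: "A \<subseteq> E" "finite A" "(\<Sum>v\<in>A. u v *\<^sub>R v) = 0" and v: "v \<in> A"
    have "0 = b (\<Sum>v\<in>A. u v *\<^sub>R v) v" using A(3) by simp
    also have "\<dots> = (\<Sum>w\<in>A. u w * (if w = v then 1 else 0))"
      unfolding sum_left scale_left
      using orthonormal[OF subsetD[OF A(1)] subsetD[OF A(1) v]] by (intro sum.cong) auto
    also have "\<dots> = u v" using A(2) v by (simp add: if_distrib cong: if_cong)
    finally show "u v = 0" by simp
  qed
  then show ?thesis
    using E by (metis dim_eq_card orthonormal_basis_def span_UNIV)
qed

end

section \<open>Representation of functionals, Cauchy-Schwarz, orthogonal decomposition\<close>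

lemma riesz:
  assumes "linear f"
  shows "\<exists>!z. \<forall>w. b z w = f w"
proof -
  obtain E where E: "orthonormal_basis b E" using orthonormal_basis_exists by blast
  have "b (\<Sum>e\<in>E. f e *\<^sub>R e) w = f w" for w
    unfolding linear_expansion[OF E assms, of w] sum_left scale_left real_scaleR_def
    by (intro sum.cong) (simp_all add: sym[of w])
  then show ?thesis by (metis eqI)
qed

text \<open>Christoffel symbols and gradients are descriptions of exactly this form, so this yields
  their defining equations.\<close>

lemma riesz_the:
  assumes "linear f"
  shows "b (THE z. \<forall>w. b z w = f w) w = f w"
  using theI'[OF riesz[OF assms]] by blast

lemma cauchy_schwarz: "b u v \<le> sqrt (b u u) * sqrt (b v v)"
proof (cases "v = 0")
  case True
  then show ?thesis by simp
next
  case False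
  then have v: "b v v > 0" by (rule pos)
  define r where "r = b u v / b v v"
  have "0 \<le> b (u - r *\<^sub>R v) (u - r *\<^sub>R v)" by simp
  also have "\<dots> = b u u - 2 * r * b u v + r\<^sup>2 * b v v"
    by (simp add: diff_left diff_right scale_left scale_right sym[of v u] power2_eq_square
        algebra_simps)
  also have "\<dots> = b u u - (b u v)\<^sup>2 / b v v"
    using v by (simp add: r_def power2_eq_square field_simps)
  finally have "(b u v)\<^sup>2 \<le> b u u * b v v"
    using v by (simp add: field_simps)
  then show ?thesis
    using real_le_rsqrt real_sqrt_mult by metis
qed

text \<open>Two candidates differ by a vector of the range of \<open>L\<close> that is also
  orthogonal to the range, hence by zero. This evaluates the description in \<open>local_sff\<close>
  once some splitting into normal and tangential parts is exhibited.\<close>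

lemma normal_component_unique:
  assumes "linear L"
    and "\<And>w. b n (L w) = 0" "c - n \<in> range L"
  shows "(THE n. (\<forall>w. b n (L w) = 0) \<and> c - n \<in> range L) = n"
proof (rule the_equality)
  show "(\<forall>w. b n (L w) = 0) \<and> c - n \<in> range L" using assms by blast
next
  fix m assume m: "(\<forall>w. b m (L w) = 0) \<and> c - m \<in> range L"
  obtain x y where "c - n = L x" "c - m = L y" using assms(3) m by blast
  then have "m - n = L (x - y)" by (simp add: linear_diff[OF assms(1)] algebra_simps)
  then have "b (m - n) (m - n) = 0" using m assms(2) by (metis diff_left diff_self)
  then show "m = n" using eq_zero_iff by simp
qed

end

lemma inner_form_inner:
  assumes "\<exists>B :: 'a::real_inner set. finite B \<and> span B = UNIV"
  shows "inner_form (\<lambda>u v :: 'a. u \<bullet> v)"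
  using assms by unfold_locales
    (auto simp: inner_commute intro!: linearI inner_right_distrib)

lemma finite_dim_prod:
  assumes "\<exists>B :: 'a::real_vector set. finite B \<and> span B = UNIV"
    and "\<exists>B :: 'b::real_vector set. finite B \<and> span B = UNIV"
  shows "\<exists>B :: ('a \<times> 'b) set. finite B \<and> span B = UNIV"
proof -
  obtain A :: "'a set" and B :: "'b set" where AB: "finite A" "finite B" "span A = UNIV" "span B = UNIV"
    using assms by blast
  define C where "C = (\<lambda>a. (a, 0::'b)) ` A \<union> (\<lambda>b. (0::'a, b)) ` B"
  have l: "linear (\<lambda>a::'a. (a, 0::'b))" "linear (\<lambda>b::'b. (0::'a, b))"
    by (auto intro!: linearI)
  have "(a, b) \<in> span C" for a b
  proof -
    have "(a, 0) \<in> (\<lambda>a. (a, 0::'b)) ` span A" "(0, b) \<in> (\<lambda>b. (0::'a, b)) ` span B"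
      using AB by auto
    then have "(a, 0) \<in> span C" "(0, b) \<in> span C"
      unfolding linear_span_image[OF l(1), symmetric] linear_span_image[OF l(2), symmetric] C_def
      by (meson Un_upper1 Un_upper2 span_mono subsetD)+
    then have "(a, 0) + (0, b) \<in> span C" by (rule span_add)
    then show ?thesis by simp
  qed
  then have "span C = UNIV" by auto
  then show ?thesis using AB by (intro exI[of _ C]) (auto simp: C_def)
qed


section \<open>Functions of class \<open>C\<^sup>k\<close> on open sets\<close>

text \<open>\<open>frechet_derivative\<close> is a choice from the predicate
  \<open>has_derivative\<close>, and at a point of \<open>S\<close> the predicate within
  \<open>S\<close> depends only on values on \<open>S\<close>. The chosen derivatives are therefore
  equal, and the induction continues with them.\<close>

lemma Ck_on_cong:
  assumes "\<And>x. x \<in> S \<Longrightarrow> f x = g x"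
  shows "Ck_on k S f \<longleftrightarrow> Ck_on k S g"
  using assms
proof (induction k arbitrary: f g)
  case 0
  then show ?case by (simp cong: continuous_on_cong)
next
  case (Suc k)
  have eq: "(f has_derivative f') (at x within S) \<longleftrightarrow> (g has_derivative f') (at x within S)"
    if "x \<in> S" for x f'
    using Suc.prems that by (metis has_derivative_transform)
  then have "frechet_derivative f (at x within S) = frechet_derivative g (at x within S)"
    if "x \<in> S" for x
    using that by (simp add: frechet_derivative_def)
  then have "Ck_on k S (\<lambda>x. frechet_derivative f (at x within S) v)
      \<longleftrightarrow> Ck_on k S (\<lambda>x. frechet_derivative g (at x within S) v)" for v
    by (intro Suc.IH) simp
  then show ?case
    using eq by (simp add: differentiable_on_def differentiable_def)
qed

lemma Ck_on_Suc_open: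
  assumes "open S"
  shows "Ck_on (Suc k) S f \<longleftrightarrow>
    (\<forall>x\<in>S. f differentiable (at x)) \<and> (\<forall>v. Ck_on k S (\<lambda>x. deriv_at f x v))"
proof -
  have "Ck_on k S (\<lambda>x. frechet_derivative f (at x within S) v) \<longleftrightarrow> Ck_on k S (\<lambda>x. deriv_at f x v)" for v
    by (intro Ck_on_cong) (simp add: at_within_open[OF _ assms])
  then show ?thesis
    using assms by (auto simp: differentiable_on_def at_within_open[OF _ assms])
qed

lemma Ck_on_has_derivative:
  assumes "Ck_on (Suc k) S f" "open S" "x \<in> S"
  shows "(f has_derivative deriv_at f x) (at x)"
  using assms by (metis Ck_on_Suc_open frechet_derivative_works)

lemma Ck_on_deriv:
  assumes "Ck_on (Suc k) S f" "open S"
  shows "Ck_on k S (\<lambda>x. deriv_at f x v)"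
  using assms by (simp add: Ck_on_Suc_open del: Ck_on.simps)

lemma Ck_on_SucI:
  assumes "open S" "\<And>x. x \<in> S \<Longrightarrow> (f has_derivative f' x) (at x)" "\<And>v. Ck_on k S (\<lambda>x. f' x v)"
  shows "Ck_on (Suc k) S f"
proof -
  have "Ck_on k S (\<lambda>x. deriv_at f x v) \<longleftrightarrow> Ck_on k S (\<lambda>x. f' x v)" for v
    using frechet_derivative_at[OF assms(2)] by (intro Ck_on_cong) simp
  then show ?thesis
    using assms by (auto simp: Ck_on_Suc_open differentiable_def simp del: Ck_on.simps)
qed

text \<open>A chart of \<open>M\<close> need not be mapped into a single product chart, so the
  smoothness of \<gamma> is first obtained near each point and then glued.\<close>

lemma Ck_on_local:
  assumes "open S" "\<And>x. x \<in> S \<Longrightarrow> \<exists>T. open T \<and> x \<in> T \<and> Ck_on k T f"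
  shows "Ck_on k S f"
  using assms(2)
proof (induction k arbitrary: f)
  case 0
  then have "isCont f x" if "x \<in> S" for x
    using that continuous_on_eq_continuous_at[of _ f] by fastforce
  then show ?case by (simp add: continuous_at_imp_continuous_on)
next
  case (Suc k)
  show ?case
  proof (rule Ck_on_SucI[OF assms(1)])
    show "(f has_derivative deriv_at f x) (at x)" if "x \<in> S" for x
      using Suc.prems[OF that] Ck_on_has_derivative by blast
    show "Ck_on k S (\<lambda>x. deriv_at f x v)" for v
    proof (rule Suc.IH)
      show "\<exists>T. open T \<and> x \<in> T \<and> Ck_on k T (\<lambda>x. deriv_at f x v)" if "x \<in> S" for x
        using Suc.prems[OF that] Ck_on_deriv by blast
    qed
  qed
qed

text \<open>Differentiating a product or a composite leaves undifferentiated factors beside the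
  derivatives; the induction steps below need those factors at the lower order.\<close>

lemma Ck_on_pred:
  assumes "Ck_on (Suc k) S f" "open S"
  shows "Ck_on k S f"
  using assms(1)
proof (induction k arbitrary: f)
  case 0
  then show ?case by (simp add: differentiable_imp_continuous_on)
next
  case (Suc k)
  show ?case
    by (rule Ck_on_SucI[OF assms(2) Ck_on_has_derivative[OF Suc.prems assms(2)]
          Suc.IH[OF Ck_on_deriv[OF Suc.prems assms(2)]]])
qed

lemma Ck_on_const: "open S \<Longrightarrow> Ck_on k S (\<lambda>x. c)"
proof (induction k arbitrary: c)
  case (Suc k)
  then show ?case by (intro Ck_on_SucI[where f' = "\<lambda>x v. 0"]) auto
qed simp

lemma Ck_on_add:
  assumes "open S" "Ck_on k S f" "Ck_on k S g"
  shows "Ck_on k S (\<lambda>x. f x + g x)"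
  using assms(2,3)
proof (induction k arbitrary: f g)
  case 0
  then show ?case by (simp add: continuous_on_add)
next
  case (Suc k)
  show ?case
  proof (rule Ck_on_SucI[OF assms(1)])
    show "((\<lambda>x. f x + g x) has_derivative (\<lambda>v. deriv_at f x v + deriv_at g x v)) (at x)"
      if "x \<in> S" for x
      using that Suc.prems assms(1) by (intro has_derivative_add) (auto intro: Ck_on_has_derivative simp del: Ck_on.simps)
    show "Ck_on k S (\<lambda>x. deriv_at f x v + deriv_at g x v)" for v
      using Suc.prems assms(1) by (intro Suc.IH Ck_on_deriv)
  qed
qed

lemma Ck_on_sum:
  assumes "open S" "\<And>i. i \<in> A \<Longrightarrow> Ck_on k S (f i)"
  shows "Ck_on k S (\<lambda>x. \<Sum>i\<in>A. f i x)"
  using assms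
  by (induction A rule: infinite_finite_induct) (auto intro: Ck_on_const Ck_on_add)

lemma Ck_on_scaleR:
  fixes f :: "'a::real_normed_vector \<Rightarrow> real" and g :: "'a \<Rightarrow> 'b::real_normed_vector"
  assumes "open S" "Ck_on k S f" "Ck_on k S g"
  shows "Ck_on k S (\<lambda>x. f x *\<^sub>R g x)"
  using assms(2,3)
proof (induction k arbitrary: f g)
  case 0
  then show ?case by (simp add: continuous_on_scaleR)
next
  case (Suc k)
  show ?case
  proof (rule Ck_on_SucI[OF assms(1)])
    show "((\<lambda>x. f x *\<^sub>R g x) has_derivative (\<lambda>v. f x *\<^sub>R deriv_at g x v + deriv_at f x v *\<^sub>R g x)) (at x)"
      if "x \<in> S" for x
      using that Suc.prems assms(1) by (intro has_derivative_scaleR) (auto intro: Ck_on_has_derivative simp del: Ck_on.simps)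
    show "Ck_on k S (\<lambda>x. f x *\<^sub>R deriv_at g x v + deriv_at f x v *\<^sub>R g x)" for v
      by (rule Ck_on_add[OF assms(1) Suc.IH[OF Ck_on_pred[OF Suc.prems(1) assms(1)]
              Ck_on_deriv[OF Suc.prems(2) assms(1)]]
            Suc.IH[OF Ck_on_deriv[OF Suc.prems(1) assms(1)] Ck_on_pred[OF Suc.prems(2) assms(1)]]])
  qed
qed

lemma Ck_on_bounded_linear:
  assumes "bounded_linear L" "open S" "Ck_on k S f"
  shows "Ck_on k S (\<lambda>x. L (f x))"
  using assms(3)
proof (induction k arbitrary: f)
  case 0
  then show ?case using assms(1) by (simp add: bounded_linear.continuous_on)
next
  case (Suc k)
  show ?case
  proof (rule Ck_on_SucI[OF assms(2)])
    show "((\<lambda>x. L (f x)) has_derivative (\<lambda>v. L (deriv_at f x v))) (at x)" if "x \<in> S" for x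
      using that Suc.prems assms(1,2)
      by (intro bounded_linear.has_derivative[OF assms(1)]) (rule Ck_on_has_derivative)
    show "Ck_on k S (\<lambda>x. L (deriv_at f x v))" for v
      using Suc.prems assms(2) by (intro Suc.IH Ck_on_deriv)
  qed
qed

text \<open>The derivative of the composite is expanded in an orthonormal basis of the middle space.
  Each term is a coefficient of \<open>deriv_at F x v\<close> times
  \<open>deriv_at f (F x) e\<close> with \<open>e\<close> fixed, so the induction hypothesis applies
  to \<open>\<lambda>y. deriv_at f y e\<close>.\<close>

lemma Ck_on_compose:
  fixes F :: "'a::real_normed_vector \<Rightarrow> 'b::real_inner" and f :: "'b \<Rightarrow> 'c::real_normed_vector"
  assumes fd: "\<exists>B :: 'b set. finite B \<and> span B = UNIV"
    and S: "open S" and T: "open T" and ST: "F ` S \<subseteq> T"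
    and F: "Ck_on k S F" and f: "Ck_on k T f"
  shows "Ck_on k S (\<lambda>x. f (F x))"
  using F f
proof (induction k arbitrary: f)
  case 0
  then show ?case using ST by (auto intro: continuous_on_compose2)
next
  case (Suc k)
  interpret inner_form "\<lambda>u v :: 'b. u \<bullet> v" by (rule inner_form_inner[OF fd])
  obtain E :: "'b set" where E: "orthonormal_basis (\<bullet>) E"
    using orthonormal_basis_exists by blast
  show ?case
  proof (rule Ck_on_SucI[OF S])
    fix x assume x: "x \<in> S"
    have f': "(f has_derivative deriv_at f (F x)) (at (F x))"
      using x ST Suc.prems(2) T by (intro Ck_on_has_derivative) auto
    have "((\<lambda>x. f (F x)) has_derivative (\<lambda>v. deriv_at f (F x) (deriv_at F x v))) (at x)"
      by (rule has_derivative_compose[OF Ck_on_has_derivative[OF Suc.prems(1) S x] f'])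
    then show "((\<lambda>x. f (F x)) has_derivative
        (\<lambda>v. \<Sum>e\<in>E. (deriv_at F x v \<bullet> e) *\<^sub>R deriv_at f (F x) e)) (at x)"
      by (simp add: linear_expansion[OF E has_derivative_linear[OF f'], symmetric])
  next
    fix v
    have "Ck_on k S (\<lambda>x. deriv_at F x v \<bullet> e)" for e
      using bounded_linear_inner_left S Suc.prems(1)
      by (intro Ck_on_bounded_linear[where L = "\<lambda>z. z \<bullet> e"] Ck_on_deriv)
    moreover have "Ck_on k S (\<lambda>x. deriv_at f (F x) e)" for e
      using Suc.prems S T Ck_on_pred Ck_on_deriv Suc.IH[of "\<lambda>y. deriv_at f y e"] by blast
    ultimately show "Ck_on k S (\<lambda>x. \<Sum>e\<in>E. (deriv_at F x v \<bullet> e) *\<^sub>R deriv_at f (F x) e)"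
      by (intro Ck_on_sum Ck_on_scaleR S)
  qed
qed

text \<open>A product rule in which \<open>A\<close> is differentiated only at fixed vectors. Finite
  dimension turns \<open>A y (a y)\<close> into a finite sum of coefficients of \<open>a y\<close>
  times the functions \<open>A y e\<close>.\<close>

lemma has_derivative_apply_linear:
  fixes A :: "'a::real_normed_vector \<Rightarrow> 'b::real_inner \<Rightarrow> 'c::real_normed_vector"
  assumes fd: "\<exists>B :: 'b set. finite B \<and> span B = UNIV"
    and U: "open U" "x \<in> U" and lin: "\<And>y. y \<in> U \<Longrightarrow> linear (A y)"
    and A': "\<And>v. ((\<lambda>y. A y v) has_derivative A' v) (at x)"
    and a: "(a has_derivative a') (at x)"
  shows "((\<lambda>y. A y (a y)) has_derivative (\<lambda>u. A' (a x) u + A x (a' u))) (at x)"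
proof -
  interpret inner_form "\<lambda>u v :: 'b. u \<bullet> v" by (rule inner_form_inner[OF fd])
  obtain E :: "'b set" where E: "orthonormal_basis (\<bullet>) E"
    using orthonormal_basis_exists by blast
  note ex = linear_expansion[OF E lin]
  \<comment> \<open>Linearity of \<open>A'\<close> in \<open>v\<close> is derived here: both sides
    are derivatives at \<open>x\<close> of the same function, since every \<open>A y\<close> with
    \<open>y\<close> in \<open>U\<close> is linear.\<close>
  have A'_ex: "A' v = (\<lambda>u. \<Sum>e\<in>E. (v \<bullet> e) *\<^sub>R A' e u)" for v
  proof (rule has_derivative_unique[OF A'])
    have "((\<lambda>y. \<Sum>e\<in>E. (v \<bullet> e) *\<^sub>R A y e) has_derivative (\<lambda>u. \<Sum>e\<in>E. (v \<bullet> e) *\<^sub>R A' e u)) (at x)"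
      by (intro has_derivative_sum has_derivative_scaleR_right A')
    then show "((\<lambda>y. A y v) has_derivative (\<lambda>u. \<Sum>e\<in>E. (v \<bullet> e) *\<^sub>R A' e u)) (at x)"
      by (rule has_derivative_transform_within_open[OF _ U]) (rule ex[symmetric])
  qed
  have "((\<lambda>y. \<Sum>e\<in>E. (a y \<bullet> e) *\<^sub>R A y e) has_derivative
      (\<lambda>u. \<Sum>e\<in>E. (a x \<bullet> e) *\<^sub>R A' e u + (a' u \<bullet> e) *\<^sub>R A x e)) (at x)"
    by (intro has_derivative_sum has_derivative_scaleR A' has_derivative_inner_left a)
  then have "((\<lambda>y. A y (a y)) has_derivative
      (\<lambda>u. \<Sum>e\<in>E. (a x \<bullet> e) *\<^sub>R A' e u + (a' u \<bullet> e) *\<^sub>R A x e)) (at x)"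
    by (rule has_derivative_transform_within_open[OF _ U]) (rule ex[symmetric])
  moreover have "(\<Sum>e\<in>E. (a x \<bullet> e) *\<^sub>R A' e u + (a' u \<bullet> e) *\<^sub>R A x e) = A' (a x) u + A x (a' u)" for u
    using A'_ex[of "a x"] ex[OF U(2), of "a' u"] by (simp add: sum.distrib)
  ultimately show ?thesis by simp
qed

text \<open>Both iterated derivatives are the limit of the second difference quotients of \<open>f\<close> on
  shrinking parallelograms.\<close>

lemma second_difference_quotient:
  fixes f :: "'a::real_normed_vector \<Rightarrow> real"
  assumes f: "Ck_on 2 S f" and S: "open S" "x \<in> S" and \<epsilon>: "\<epsilon> > 0"
  shows "\<exists>\<delta>>0. \<forall>t. 0 < t \<longrightarrow> t < \<delta> \<longrightarrow>
    \<bar>(f (x + t *\<^sub>R u + t *\<^sub>R v) - f (x + t *\<^sub>R u) - f (x + t *\<^sub>R v) + f x) / t\<^sup>2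
      - deriv_at (\<lambda>y. deriv_at f y u) x v\<bar> < \<epsilon>"
proof -
  define D where "D = (\<lambda>y. deriv_at (\<lambda>y. deriv_at f y u) y v)"
  have f1: "Ck_on (Suc (Suc 0)) S f" using f by (simp add: numeral_2_eq_2)
  have d1: "(f has_derivative deriv_at f y) (at y)" if "y \<in> S" for y
    using f1 S(1) that by (rule Ck_on_has_derivative)
  have f2: "Ck_on (Suc 0) S (\<lambda>y. deriv_at f y u)" using f1 S(1) by (rule Ck_on_deriv)
  have d2: "((\<lambda>y. deriv_at f y u) has_derivative deriv_at (\<lambda>y. deriv_at f y u) y) (at y)" if "y \<in> S" for y
    using f2 S(1) that by (rule Ck_on_has_derivative)
  have "continuous_on S D"
    using Ck_on_deriv[OF f2 S(1), of v] by (simp add: D_def)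
  then have "isCont D x" using S continuous_on_eq_continuous_at by blast
  then obtain d where d: "d > 0" "\<And>y. dist y x < d \<Longrightarrow> \<bar>D y - D x\<bar> < \<epsilon>"
    using \<epsilon> by (metis continuous_at_eps_delta dist_real_def)
  obtain r where r: "r > 0" "ball x r \<subseteq> S" using S open_contains_ball by blast
  \<comment> \<open>For 0 < t < \<delta> the parallelogram with sides t u and t v stays inside
    \<open>S\<close> and where \<open>D\<close> is \<epsilon>-close to \<open>D x\<close>. The added
    1 keeps the denominator positive if u = v = 0.\<close>
  define \<delta> where "\<delta> = min d r / (norm u + norm v + 1)"
  have pos: "norm u + norm v + 1 > 0" by (simp add: add_nonneg_pos)
  have "\<delta> > 0" using d r pos by (simp add: \<delta>_def)
  have near: "dist (x + s *\<^sub>R u + s' *\<^sub>R v) x < min d r"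
    if "0 \<le> s" "s \<le> t" "0 \<le> s'" "s' \<le> t" "0 < t" "t < \<delta>" for s s' t
  proof -
    have "norm (s *\<^sub>R u + s' *\<^sub>R v) \<le> norm (s *\<^sub>R u) + norm (s' *\<^sub>R v)" by (rule norm_triangle_ineq)
    also have "\<dots> \<le> t * norm u + t * norm v"
      using that by (simp add: add_mono mult_right_mono)
    also have "\<dots> \<le> t * (norm u + norm v + 1)" using that by (simp add: algebra_simps)
    also have "\<dots> < min d r" using that(6) pos by (simp add: \<delta>_def pos_less_divide_eq)
    finally show ?thesis by (simp add: dist_norm add.assoc)
  qed
  then have inS: "x + s *\<^sub>R u + s' *\<^sub>R v \<in> S"
    if "0 \<le> s" "s \<le> t" "0 \<le> s'" "s' \<le> t" "0 < t" "t < \<delta>" for s s' t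
    using that r(2) by (force simp: dist_commute subset_iff)
  have "\<bar>(f (x + t *\<^sub>R u + t *\<^sub>R v) - f (x + t *\<^sub>R u) - f (x + t *\<^sub>R v) + f x) / t\<^sup>2 - D x\<bar> < \<epsilon>"
    if t: "0 < t" "t < \<delta>" for t
  proof -
    \<comment> \<open>The second difference is \<phi> t - \<phi> 0. The mean value theorem in the
      direction \<open>u\<close>, and then in the direction \<open>v\<close>, turns it into t^2
      times \<open>D\<close> at an inner point. The term \<open>0 *\<^sub>R v\<close> makes both
      summands instances of \<open>part\<close>.\<close>
    define \<phi> where "\<phi> = (\<lambda>s. f (x + s *\<^sub>R u + t *\<^sub>R v) - f (x + s *\<^sub>R u + 0 *\<^sub>R v))"
    have part: "((\<lambda>s. f (x + s *\<^sub>R u + s' *\<^sub>R v)) has_derivative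
        (\<lambda>h. h * deriv_at f (x + s *\<^sub>R u + s' *\<^sub>R v) u)) (at s)"
      if "0 \<le> s" "s \<le> t" "0 \<le> s'" "s' \<le> t" for s s'
    proof -
      note df = d1[OF inS[OF that t]]
      have "((\<lambda>s. f (x + s *\<^sub>R u + s' *\<^sub>R v)) has_derivative
          (\<lambda>h. deriv_at f (x + s *\<^sub>R u + s' *\<^sub>R v) (h *\<^sub>R u))) (at s)"
        by (rule has_derivative_compose[where f = "\<lambda>s. x + s *\<^sub>R u + s' *\<^sub>R v" and g = f, OF _ df]) (auto intro!: derivative_eq_intros)
      then show ?thesis using linear_cmul[OF has_derivative_linear[OF df]] by simp
    qed
    have "(\<phi> has_derivative (\<lambda>h. h * (deriv_at f (x + s *\<^sub>R u + t *\<^sub>R v) u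
        - deriv_at f (x + s *\<^sub>R u + 0 *\<^sub>R v) u))) (at s within {0..t})"
      if "0 \<le> s" "s \<le> t" for s
      unfolding \<phi>_def right_diff_distrib
      by (rule has_derivative_at_withinI[OF has_derivative_diff[OF part part]]) (use that t in auto)
    from mvt_simple[OF t(1) this] obtain s where s: "0 < s" "s < t"
      "\<phi> t - \<phi> 0 = t * (deriv_at f (x + s *\<^sub>R u + t *\<^sub>R v) u - deriv_at f (x + s *\<^sub>R u + 0 *\<^sub>R v) u)"
      by auto
    have "((\<lambda>s'. deriv_at f (x + s *\<^sub>R u + s' *\<^sub>R v) u) has_derivative
        (\<lambda>h. h * D (x + s *\<^sub>R u + s' *\<^sub>R v))) (at s' within {0..t})"
      if "0 \<le> s'" "s' \<le> t" for s'
    proof -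
      have "x + s *\<^sub>R u + s' *\<^sub>R v \<in> S" using s that by (intro inS[OF _ _ _ _ t]) auto
      note df = d2[OF this]
      have "((\<lambda>s'. deriv_at f (x + s *\<^sub>R u + s' *\<^sub>R v) u) has_derivative
          (\<lambda>h. deriv_at (\<lambda>y. deriv_at f y u) (x + s *\<^sub>R u + s' *\<^sub>R v) (h *\<^sub>R v))) (at s')"
        by (rule has_derivative_compose[where f = "\<lambda>s'. x + s *\<^sub>R u + s' *\<^sub>R v" and
              g = "\<lambda>y. deriv_at f y u", OF _ df])
          (auto intro!: derivative_eq_intros)
      then show ?thesis using linear_cmul[OF has_derivative_linear[OF df]]
        by (simp add: D_def has_derivative_at_withinI)
    qed
    from mvt_simple[OF t(1) this] obtain s' where s': "0 < s'" "s' < t"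
      "deriv_at f (x + s *\<^sub>R u + t *\<^sub>R v) u - deriv_at f (x + s *\<^sub>R u + 0 *\<^sub>R v) u
        = t * D (x + s *\<^sub>R u + s' *\<^sub>R v)"
      by auto
    have "f (x + t *\<^sub>R u + t *\<^sub>R v) - f (x + t *\<^sub>R u) - f (x + t *\<^sub>R v) + f x = \<phi> t - \<phi> 0"
      by (simp add: \<phi>_def)
    then have "(f (x + t *\<^sub>R u + t *\<^sub>R v) - f (x + t *\<^sub>R u) - f (x + t *\<^sub>R v) + f x) / t\<^sup>2
        = D (x + s *\<^sub>R u + s' *\<^sub>R v)"
      using s(3) s'(3) t by (simp add: power2_eq_square)
    moreover have "dist (x + s *\<^sub>R u + s' *\<^sub>R v) x < d"
      using near[OF _ _ _ _ t, of s s'] s s' by auto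
    ultimately show ?thesis using d(2) by metis
  qed
  then show ?thesis using \<open>\<delta> > 0\<close> unfolding D_def by blast
qed

lemma second_derivative_symmetric_real:
  fixes f :: "'a::real_normed_vector \<Rightarrow> real"
  assumes f: "Ck_on 2 S f" and S: "open S" "x \<in> S"
  shows "deriv_at (\<lambda>y. deriv_at f y u) x v = deriv_at (\<lambda>y. deriv_at f y v) x u"
proof (rule ccontr)
  let ?a = "deriv_at (\<lambda>y. deriv_at f y u) x v" and ?b = "deriv_at (\<lambda>y. deriv_at f y v) x u"
  assume "?a \<noteq> ?b"
  \<comment> \<open>The difference quotients for (u, v) and (v, u) coincide, and no number is closer
    than half the gap to both limits.\<close>
  then have \<epsilon>: "\<bar>?a - ?b\<bar> / 2 > 0" by simp
  obtain \<delta>1 where \<delta>1: "\<delta>1 > 0" "\<And>t. 0 < t \<Longrightarrow> t < \<delta>1 \<Longrightarrow>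
    \<bar>(f (x + t *\<^sub>R u + t *\<^sub>R v) - f (x + t *\<^sub>R u) - f (x + t *\<^sub>R v) + f x) / t\<^sup>2 - ?a\<bar> < \<bar>?a - ?b\<bar> / 2"
    using second_difference_quotient[OF f S \<epsilon>] by blast
  obtain \<delta>2 where \<delta>2: "\<delta>2 > 0" "\<And>t. 0 < t \<Longrightarrow> t < \<delta>2 \<Longrightarrow>
    \<bar>(f (x + t *\<^sub>R v + t *\<^sub>R u) - f (x + t *\<^sub>R v) - f (x + t *\<^sub>R u) + f x) / t\<^sup>2 - ?b\<bar> < \<bar>?a - ?b\<bar> / 2"
    using second_difference_quotient[OF f S \<epsilon>] by blast
  define t where "t = min \<delta>1 \<delta>2 / 2"
  have t: "0 < t" "t < \<delta>1" "t < \<delta>2" using \<delta>1(1) \<delta>2(1) by (auto simp: t_def)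
  have "x + t *\<^sub>R v + t *\<^sub>R u = x + t *\<^sub>R u + t *\<^sub>R v" by simp
  then have "(f (x + t *\<^sub>R v + t *\<^sub>R u) - f (x + t *\<^sub>R v) - f (x + t *\<^sub>R u) + f x) / t\<^sup>2
      = (f (x + t *\<^sub>R u + t *\<^sub>R v) - f (x + t *\<^sub>R u) - f (x + t *\<^sub>R v) + f x) / t\<^sup>2"
    unfolding \<open>x + t *\<^sub>R v + t *\<^sub>R u = _\<close> by (simp add: algebra_simps)
  moreover have False if "\<bar>q - a\<bar> < \<bar>a - b\<bar> / 2" "\<bar>q - b\<bar> < \<bar>a - b\<bar> / 2" for q a b :: real
  proof -
    have "\<bar>a - b\<bar> \<le> \<bar>q - a\<bar> + \<bar>q - b\<bar>" by linarith
    then show False using that by simp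
  qed
  ultimately show False using \<delta>1(2)[OF t(1,2)] \<delta>2(2)[OF t(1,3)] by metis
qed

text \<open>Pairing with a fixed \<open>w\<close> commutes with both derivatives and such pairings
  separate vectors, which reduces the claim to real functions.\<close>

lemma second_derivative_symmetric:
  fixes F :: "'a::real_normed_vector \<Rightarrow> 'b::real_inner"
  assumes F: "Ck_on 2 S F" and S: "open S" "x \<in> S"
  shows "deriv_at (\<lambda>y. deriv_at F y u) x v = deriv_at (\<lambda>y. deriv_at F y v) x u"
proof -
  have F1: "Ck_on (Suc (Suc 0)) S F" using F by (simp add: numeral_2_eq_2)
  have d: "deriv_at (\<lambda>y. deriv_at F y u) x v \<bullet> w = deriv_at (\<lambda>y. deriv_at (\<lambda>z. F z \<bullet> w) y u) x v"
    for u v w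
  proof -
    have eq: "deriv_at F y u \<bullet> w = deriv_at (\<lambda>z. F z \<bullet> w) y u" if "y \<in> S" for y
      using frechet_derivative_at[OF has_derivative_inner_left[OF Ck_on_has_derivative[OF F1 S(1) that]], of w]
      by (simp add: fun_eq_iff)
    have "((\<lambda>y. deriv_at F y u \<bullet> w) has_derivative (\<lambda>v. deriv_at (\<lambda>y. deriv_at F y u) x v \<bullet> w)) (at x)"
      using has_derivative_inner_left[OF Ck_on_has_derivative[OF Ck_on_deriv[OF F1 S(1)] S]] .
    then have "((\<lambda>y. deriv_at (\<lambda>z. F z \<bullet> w) y u) has_derivative
        (\<lambda>v. deriv_at (\<lambda>y. deriv_at F y u) x v \<bullet> w)) (at x)"
      by (rule has_derivative_transform_within_open[OF _ S]) (rule eq)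
    from frechet_derivative_at[OF this] show ?thesis by (simp add: fun_eq_iff)
  qed
  have "Ck_on 2 S (\<lambda>z. F z \<bullet> w)" for w
    using bounded_linear_inner_left S(1) F by (rule Ck_on_bounded_linear)
  then show ?thesis
    using second_derivative_symmetric_real S d by (metis vector_eq_rdot)
qed


section \<open>Levi-Civita connection and Gauss formula in coordinates\<close>

text \<open>The functional of \<open>w\<close> that \<open>christoffel\<close> represents.
  Identities between connections are proved for these functionals, and vectors are recovered from
  them only at the end.\<close>

definition koszul :: "('e::real_inner) local_metric \<Rightarrow> 'e \<Rightarrow> 'e \<Rightarrow> 'e \<Rightarrow> 'e \<Rightarrow> real" where
  "koszul g x u v w = (deriv_at (\<lambda>y. g y v w) x u + deriv_at (\<lambda>y. g y u w) x v
     - deriv_at (\<lambda>y. g y u v) x w) / 2"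

text \<open>Charts of \<open>X\<close>, \<open>V\<close> and \<open>M\<close> and product charts
  with the warped metric are all instances, so one calculus serves both the ambient and the induced
  geometry.\<close>

locale coord_metric =
  fixes g :: "('e::real_inner) local_metric" and U :: "'e set"
  assumes open_dom: "open U"
    and form: "y \<in> U \<Longrightarrow> inner_form (g y)"
    and differentiable: "y \<in> U \<Longrightarrow> (\<lambda>z. g z u v) differentiable (at y)"
begin

lemma has_derivative: "y \<in> U \<Longrightarrow> ((\<lambda>z. g z u v) has_derivative deriv_at (\<lambda>z. g z u v) y) (at y)"
  using differentiable by (simp add: frechet_derivative_works)

lemma linear_deriv_right:
  assumes "x \<in> U"
  shows "linear (\<lambda>w. deriv_at (\<lambda>y. g y v w) x u)"
proof (rule linearI)
  note cong = has_derivative_transform_within_open[OF _ open_dom assms]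
  fix w w'
  have "((\<lambda>y. g y v (w + w')) has_derivative
      (\<lambda>u. deriv_at (\<lambda>y. g y v w) x u + deriv_at (\<lambda>y. g y v w') x u)) (at x)"
    by (rule cong[OF has_derivative_add[OF has_derivative has_derivative]])
      (use assms form in \<open>auto simp: inner_form.add_right\<close>)
  from frechet_derivative_at[OF this]
  show "deriv_at (\<lambda>y. g y v (w + w')) x u
      = deriv_at (\<lambda>y. g y v w) x u + deriv_at (\<lambda>y. g y v w') x u"
    by (simp add: fun_eq_iff)
next
  note cong = has_derivative_transform_within_open[OF _ open_dom assms]
  fix r w
  have "((\<lambda>y. g y v (r *\<^sub>R w)) has_derivative (\<lambda>u. r *\<^sub>R deriv_at (\<lambda>y. g y v w) x u)) (at x)"
    by (rule cong[OF has_derivative_scaleR_right[OF has_derivative]])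
      (use assms form in \<open>auto simp: inner_form.scale_right\<close>)
  from frechet_derivative_at[OF this]
  show "deriv_at (\<lambda>y. g y v (r *\<^sub>R w)) x u = r *\<^sub>R deriv_at (\<lambda>y. g y v w) x u"
    by (simp add: fun_eq_iff)
qed

lemma linear_koszul:
  assumes "x \<in> U"
  shows "linear (koszul g x u v)"
proof -
  have "linear (\<lambda>w. (1/2) *\<^sub>R (deriv_at (\<lambda>y. g y v w) x u + deriv_at (\<lambda>y. g y u w) x v
     - deriv_at (\<lambda>y. g y u v) x w))"
    by (intro linear_compose_scale_right linear_compose_add linear_compose_sub linear_deriv_right assms
        has_derivative_linear[OF has_derivative])
  then show ?thesis unfolding koszul_def by simp
qed

lemma christoffel: "x \<in> U \<Longrightarrow> g x (christoffel g x u v) w = koszul g x u v w"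
  using inner_form.riesz_the[OF form linear_koszul] unfolding christoffel_def koszul_def .

text \<open>The product rule is applied once for each vector argument; the three terms come from the
  moving base point and the two moving vectors.\<close>

lemma has_derivative_along:
  fixes F :: "'a::real_normed_vector \<Rightarrow> 'e"
  assumes S: "open S" "x \<in> S" "F ` S \<subseteq> U"
    and F: "(F has_derivative F') (at x)"
    and a: "(a has_derivative a') (at x)" and b: "(b has_derivative b') (at x)"
  shows "((\<lambda>y. g (F y) (a y) (b y)) has_derivative
    (\<lambda>u. deriv_at (\<lambda>z. g z (a x) (b x)) (F x) (F' u) + g (F x) (a' u) (b x) + g (F x) (a x) (b' u))) (at x)"
proof -
  have FU: "y \<in> S \<Longrightarrow> F y \<in> U" for y using S by auto
  have fd: "\<exists>B :: 'e set. finite B \<and> span B = UNIV"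
    using form[OF FU[OF S(2)]] by (rule inner_form.finite_dim)
  have 1: "((\<lambda>y. g (F y) v w) has_derivative (\<lambda>u. deriv_at (\<lambda>z. g z v w) (F x) (F' u))) (at x)" for v w
    by (rule has_derivative_compose[OF F has_derivative[OF FU[OF S(2)]]])
  have 2: "((\<lambda>y. g (F y) v (b y)) has_derivative
    (\<lambda>u. deriv_at (\<lambda>z. g z v (b x)) (F x) (F' u) + g (F x) v (b' u))) (at x)" for v
    by (rule has_derivative_apply_linear[OF fd S(1,2) _ 1 b])
      (use FU form inner_form.linear_right in blast)
  have "((\<lambda>y. g (F y) (a y) (b y)) has_derivative
    (\<lambda>u. (deriv_at (\<lambda>z. g z (a x) (b x)) (F x) (F' u) + g (F x) (a x) (b' u)) + g (F x) (a' u) (b x))) (at x)"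
    by (rule has_derivative_apply_linear[OF fd S(1,2) _ 2 a])
      (use FU form inner_form.linear_left in blast)
  then show ?thesis by (simp add: algebra_simps)
qed

text \<open>Differentiating the induced metric gives the ambient Koszul expression on image vectors
  plus terms with second derivatives of \<open>F\<close>. The result identifies the induced
  connection with the tangential part of the ambient one.\<close>

lemma koszul_pullback:
  fixes F :: "'a::real_inner \<Rightarrow> 'e"
  assumes S: "open S" "x \<in> S" "F ` S \<subseteq> U"
    and F: "Ck_on 2 S F"
    and m: "\<And>y u v. y \<in> S \<Longrightarrow> m y u v = g (F y) (deriv_at F y u) (deriv_at F y v)"
  shows "koszul m x u u w = g (F x) (local_cov_deriv g F x u u) (deriv_at F x w)"
proof -
  have F1: "Ck_on (Suc (Suc 0)) S F" using F by (simp add: numeral_2_eq_2)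
  have x: "F x \<in> U" using S by auto
  interpret inner_form "g (F x)" using x by (rule form)
  note dF = Ck_on_has_derivative[OF F1 S(1,2)]
  note ddF = Ck_on_has_derivative[OF Ck_on_deriv[OF F1 S(1)] S(1,2)]
  define F2 where "F2 = (\<lambda>u v. deriv_at (\<lambda>y. deriv_at F y u) x v)"
  have "((\<lambda>y. m y u v) has_derivative
      (\<lambda>w. deriv_at (\<lambda>z. g z (deriv_at F x u) (deriv_at F x v)) (F x) (deriv_at F x w)
      + g (F x) (F2 u w) (deriv_at F x v) + g (F x) (deriv_at F x u) (F2 v w))) (at x)" for u v
    unfolding F2_def
    by (rule has_derivative_transform_within_open[OF has_derivative_along[OF S dF ddF ddF] S(1,2)])
      (simp add: m)
  from frechet_derivative_at[OF this]
  have dm: "deriv_at (\<lambda>y. m y u v) x w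
      = deriv_at (\<lambda>z. g z (deriv_at F x u) (deriv_at F x v)) (F x) (deriv_at F x w)
      + g (F x) (F2 u w) (deriv_at F x v) + g (F x) (deriv_at F x u) (F2 v w)" for u v w
    by (simp add: fun_eq_iff)
  \<comment> \<open>With this symmetry the terms that pair \<open>deriv_at F x u\<close> with the
    mixed second derivative cancel, and only \<open>F2 u u\<close> survives.\<close>
  have "F2 w u = F2 u w"
    unfolding F2_def by (rule second_derivative_symmetric[OF F S(1,2)])
  then have "koszul m x u u w
      = koszul g (F x) (deriv_at F x u) (deriv_at F x u) (deriv_at F x w)
        + g (F x) (F2 u u) (deriv_at F x w)"
    unfolding koszul_def dm using sym by (simp add: field_simps)
  also have "\<dots> = g (F x) (local_cov_deriv g F x u u) (deriv_at F x w)"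
    unfolding christoffel[OF x, symmetric] local_cov_deriv_def F2_def by (simp add: add_left)
  finally show ?thesis .
qed

text \<open>The tangential part of the ambient covariant derivative is the intrinsic one, since both
  are determined by the Koszul formula.\<close>

lemma gauss_formula:
  fixes F :: "'a::real_inner \<Rightarrow> 'e"
  assumes S: "open S" "x \<in> S" "F ` S \<subseteq> U"
    and F: "Ck_on 2 S F"
    and m: "coord_metric m S" "\<And>y u v. y \<in> S \<Longrightarrow> m y u v = g (F y) (deriv_at F y u) (deriv_at F y v)"
  shows "local_cov_deriv g F x u u = local_sff g F x u u + deriv_at F x (christoffel m x u u)"
proof -
  have F1: "Ck_on (Suc (Suc 0)) S F" using F by (simp add: numeral_2_eq_2)
  have x: "F x \<in> U" using S by auto
  interpret inner_form "g (F x)" using x by (rule form)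
  have L: "linear (deriv_at F x)"
    by (rule has_derivative_linear[OF Ck_on_has_derivative[OF F1 S(1,2)]])
  let ?t = "deriv_at F x (christoffel m x u u)"
  have "g (F x) ?t (deriv_at F x w) = g (F x) (local_cov_deriv g F x u u) (deriv_at F x w)" for w
    using coord_metric.christoffel[OF m(1) S(2)] m(2)[OF S(2)]
      koszul_pullback[OF S F, of m, OF m(2)] by metis
  then have "local_sff g F x u u = local_cov_deriv g F x u u - ?t"
    unfolding local_sff_def by (intro normal_component_unique[OF L]) (auto simp: diff_left)
  then show ?thesis by simp
qed

end

lemma second_derivative_compose:
  fixes F :: "'a::real_normed_vector \<Rightarrow> 'b::real_inner" and f :: "'b \<Rightarrow> real"
  assumes fd: "\<exists>B :: 'b set. finite B \<and> span B = UNIV"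
    and S: "open S" "x \<in> S" and T: "open T" "F ` S \<subseteq> T"
    and F: "Ck_on 2 S F" and f: "Ck_on 2 T f"
  shows "deriv_at (\<lambda>y. deriv_at (\<lambda>z. f (F z)) y v) x u
    = deriv_at (\<lambda>y. deriv_at f y (deriv_at F x v)) (F x) (deriv_at F x u)
      + deriv_at f (F x) (deriv_at (\<lambda>y. deriv_at F y v) x u)"
    and "deriv_at (\<lambda>z. f (F z)) x v = deriv_at f (F x) (deriv_at F x v)"
proof -
  have F1: "Ck_on (Suc (Suc 0)) S F" using F by (simp add: numeral_2_eq_2)
  have f1: "Ck_on (Suc (Suc 0)) T f" using f by (simp add: numeral_2_eq_2)
  have FT: "y \<in> S \<Longrightarrow> F y \<in> T" for y using T by auto
  note df = Ck_on_has_derivative[OF f1 T(1) FT]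
  note dF = Ck_on_has_derivative[OF F1 S(1)]
  have eq: "deriv_at f (F y) (deriv_at F y v) = deriv_at (\<lambda>z. f (F z)) y v" if "y \<in> S" for y v
    using frechet_derivative_at[OF has_derivative_compose[OF dF[OF that] df[OF that]]]
    by (simp add: fun_eq_iff)
  show "deriv_at (\<lambda>z. f (F z)) x v = deriv_at f (F x) (deriv_at F x v)"
    using eq S(2) by simp
  have A': "((\<lambda>y. deriv_at f (F y) w) has_derivative
      (\<lambda>u. deriv_at (\<lambda>y. deriv_at f y w) (F x) (deriv_at F x u))) (at x)" for w
    by (rule has_derivative_compose[OF dF[OF S(2)] Ck_on_has_derivative[OF Ck_on_deriv[OF f1 T(1)] T(1) FT[OF S(2)]]])
  have "((\<lambda>y. deriv_at f (F y) (deriv_at F y v)) has_derivative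
      (\<lambda>u. deriv_at (\<lambda>y. deriv_at f y (deriv_at F x v)) (F x) (deriv_at F x u)
      + deriv_at f (F x) (deriv_at (\<lambda>y. deriv_at F y v) x u))) (at x)"
    by (rule has_derivative_apply_linear[OF fd S has_derivative_linear[OF df] A'
        Ck_on_has_derivative[OF Ck_on_deriv[OF F1 S(1)] S]])
  then have "((\<lambda>y. deriv_at (\<lambda>z. f (F z)) y v) has_derivative
      (\<lambda>u. deriv_at (\<lambda>y. deriv_at f y (deriv_at F x v)) (F x) (deriv_at F x u)
      + deriv_at f (F x) (deriv_at (\<lambda>y. deriv_at F y v) x u))) (at x)"
    by (rule has_derivative_transform_within_open[OF _ S]) (rule eq)
  from frechet_derivative_at[OF this]
  show "deriv_at (\<lambda>y. deriv_at (\<lambda>z. f (F z)) y v) x u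
    = deriv_at (\<lambda>y. deriv_at f y (deriv_at F x v)) (F x) (deriv_at F x u)
      + deriv_at f (F x) (deriv_at (\<lambda>y. deriv_at F y v) x u)"
    by (simp add: fun_eq_iff)
qed


section \<open>Warped products in coordinates\<close>

definition warped_metric ::
  "('e::real_inner) local_metric \<Rightarrow> ('e \<Rightarrow> real) \<Rightarrow> ('f::real_inner) local_metric \<Rightarrow> ('e \<times> 'f) local_metric"
  where "warped_metric a p b = (\<lambda>(x, y) (u1, u2) (v1, v2). a x u1 v1 + (p x)\<^sup>2 * b y u2 v2)"

lemma warped_metric_apply:
  "warped_metric a p b z u v = a (fst z) (fst u) (fst v) + (p (fst z))\<^sup>2 * b (snd z) (snd u) (snd v)"
  by (simp add: warped_metric_def split: prod.splits)

locale warped_coord =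
  X: coord_metric a A + V: coord_metric b B
  for a :: "('e::real_inner) local_metric" and A and b :: "('f::real_inner) local_metric" and B +
  fixes p :: "'e \<Rightarrow> real"
  assumes p_pos: "x \<in> A \<Longrightarrow> p x > 0"
    and p_diff: "x \<in> A \<Longrightarrow> p differentiable (at x)"
begin

lemma p_deriv: "x \<in> A \<Longrightarrow> (p has_derivative deriv_at p x) (at x)"
  using p_diff by (simp add: frechet_derivative_works)

lemma inner_form_warped:
  assumes "z \<in> A \<times> B"
  shows "inner_form (warped_metric a p b z)"
proof -
  obtain x y where z: "z = (x, y)" "x \<in> A" "y \<in> B" using assms by blast
  interpret a: inner_form "a x" using z X.form by blast
  interpret b: inner_form "b y" using z V.form by blast
  show ?thesis
  proof (rule inner_form.intro)
    show "linear (warped_metric a p b z u)" for u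
      by (rule linearI) (simp_all add: z(1) warped_metric_apply a.add_right b.add_right a.scale_right
          b.scale_right algebra_simps)
    show "warped_metric a p b z u v = warped_metric a p b z v u" for u v
      by (simp add: z(1) warped_metric_apply a.sym[of "fst u"] b.sym[of "snd u"])
    show "warped_metric a p b z u u > 0" if "u \<noteq> 0" for u
    proof (cases "fst u = 0")
      case True
      then have "b y (snd u) (snd u) > 0" using that by (intro b.pos) (auto simp: prod_eq_iff)
      then show ?thesis using p_pos[OF z(2)] True by (simp add: z(1) warped_metric_apply)
    next
      case False
      then have "a x (fst u) (fst u) > 0" by (rule a.pos)
      then show ?thesis by (simp add: z(1) warped_metric_apply add_pos_nonneg)
    qed
    show "\<exists>B :: ('e \<times> 'f) set. finite B \<and> span B = UNIV"
      using a.finite_dim b.finite_dim by (rule finite_dim_prod)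
  qed
qed

lemma warped_has_derivative:
  assumes "z \<in> A \<times> B"
  shows "((\<lambda>z. warped_metric a p b z u v) has_derivative
    (\<lambda>w. deriv_at (\<lambda>x. a x (fst u) (fst v)) (fst z) (fst w)
      + ((p (fst z))\<^sup>2 * deriv_at (\<lambda>y. b y (snd u) (snd v)) (snd z) (snd w)
      + 2 * p (fst z) * deriv_at p (fst z) (fst w) * b (snd z) (snd u) (snd v)))) (at z)"
proof -
  have z: "fst z \<in> A" "snd z \<in> B" using assms by auto
  have f: "(fst has_derivative fst) (at z)" and s: "(snd has_derivative snd) (at z)"
    by (rule bounded_linear_imp_has_derivative[OF bounded_linear_fst]
        bounded_linear_imp_has_derivative[OF bounded_linear_snd])+
  have "((\<lambda>z. p (fst z)) has_derivative (\<lambda>w. deriv_at p (fst z) (fst w))) (at z)"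
    by (rule has_derivative_compose[OF f p_deriv[OF z(1)]])
  from has_derivative_power[OF this, of 2]
  have p2: "((\<lambda>z. (p (fst z))\<^sup>2) has_derivative (\<lambda>w. 2 * p (fst z) * deriv_at p (fst z) (fst w))) (at z)"
    by (simp add: mult_ac)
  show ?thesis
    unfolding warped_metric_apply
    by (intro has_derivative_add has_derivative_mult p2
        has_derivative_compose[OF f X.has_derivative[OF z(1)]]
        has_derivative_compose[OF s V.has_derivative[OF z(2)]])
qed

lemmas warped_deriv = fun_cong[OF frechet_derivative_at[OF warped_has_derivative], symmetric]

sublocale W: coord_metric "warped_metric a p b" "A \<times> B"
proof (rule coord_metric.intro)
  show "open (A \<times> B)" by (intro open_Times X.open_dom V.open_dom)
  show "inner_form (warped_metric a p b y)" if "y \<in> A \<times> B" for y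
    using that by (rule inner_form_warped)
  show "(\<lambda>z. warped_metric a p b z u v) differentiable (at y)" if "y \<in> A \<times> B" for y u v
    using warped_has_derivative[OF that] differentiable_def by blast
qed

text \<open>Only the vertical component matters, because \<gamma> depends on the second component
  alone. Pairing it with \<open>w\<close> is tested through \<open>(0, w)\<close>: the derivative of
  \<open>p\<^sup>2\<close> along \<open>fst u\<close> contributes 2 p dp(\<open>fst u\<close>)
  b(\<open>snd u\<close>, w), and dividing by \<open>p\<^sup>2\<close> gives the factor 2 dp /
  p.\<close>

lemma snd_christoffel_warped:
  assumes z: "z \<in> A \<times> B"
  shows "snd (christoffel (warped_metric a p b) z u u) = christoffel b (snd z) (snd u) (snd u)
    + (2 * deriv_at p (fst z) (fst u) / p (fst z)) *\<^sub>R snd u" (is "?l = ?r")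
proof -
  have zs: "fst z \<in> A" "snd z \<in> B" using z by auto
  interpret a: inner_form "a (fst z)" using zs X.form by blast
  interpret b: inner_form "b (snd z)" using zs V.form by blast
  have pz: "p (fst z) > 0" using p_pos zs by blast
  \<comment> \<open>Against a vertical test vector the contributions of \<open>a\<close>, and the
    derivative of \<open>p\<close> in the test direction, vanish.\<close>
  have a0: "deriv_at (\<lambda>x. a x v 0) (fst z) w = 0" for v w
    using linear_0[OF X.linear_deriv_right[OF zs(1)]] .
  have d0: "deriv_at p (fst z) 0 = 0" "deriv_at (\<lambda>x. a x v w) (fst z) 0 = 0" for v w
    using linear_0[OF has_derivative_linear[OF p_deriv[OF zs(1)]]]
      linear_0[OF has_derivative_linear[OF X.has_derivative[OF zs(1)]]] by auto
  have "b (snd z) ?l w = b (snd z) ?r w" for w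
  proof -
    have "(p (fst z))\<^sup>2 * b (snd z) ?l w
        = warped_metric a p b z (christoffel (warped_metric a p b) z u u) (0, w)"
      by (simp add: warped_metric_apply)
    also have "\<dots> = koszul (warped_metric a p b) z u u (0, w)"
      by (rule W.christoffel[OF z])
    also have "\<dots> = (p (fst z))\<^sup>2 * koszul b (snd z) (snd u) (snd u) w
        + 2 * p (fst z) * deriv_at p (fst z) (fst u) * b (snd z) (snd u) w"
      unfolding koszul_def warped_deriv[OF z] by (simp add: a0 d0 field_simps)
    also have "\<dots> = (p (fst z))\<^sup>2 * b (snd z) ?r w"
      using pz unfolding V.christoffel[OF zs(2), symmetric]
      by (simp add: b.add_left b.scale_left field_simps power2_eq_square)
    finally show ?thesis using pz by simp
  qed
  then show ?thesis by (rule b.eqI)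
qed

text \<open>The second-order chain rule produces the vertical part of the second derivative of
  \<open>F\<close>, which the Gauss formula rewrites. The tangential part cancels the Christoffel
  correction of \<open>m\<close>, the Christoffel term of \<open>b\<close> completes the Hessian of
  \<open>f\<close>, and the normal part and the warping correction remain.\<close>

lemma hess_warped_immersion:
  fixes F :: "'c::real_inner \<Rightarrow> 'e \<times> 'f" and f :: "'f \<Rightarrow> real"
  assumes S: "open S" "x \<in> S" "F ` S \<subseteq> A \<times> B"
    and F: "Ck_on 2 S F" and f: "Ck_on 2 B f"
    and m: "coord_metric m S"
      "\<And>y u v. y \<in> S \<Longrightarrow> m y u v = warped_metric a p b (F y) (deriv_at F y u) (deriv_at F y v)"
  shows "local_hess m (\<lambda>z. f (snd (F z))) x u u
    = local_hess b f (snd (F x)) (snd (deriv_at F x u)) (snd (deriv_at F x u))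
      + deriv_at f (snd (F x)) (snd (local_sff (warped_metric a p b) F x u u))
      - 2 * deriv_at p (fst (F x)) (fst (deriv_at F x u)) / p (fst (F x))
          * deriv_at f (snd (F x)) (snd (deriv_at F x u))" (is ?hess)
    and "deriv_at (\<lambda>z. f (snd (F z))) x u = deriv_at f (snd (F x)) (snd (deriv_at F x u))" (is ?grad)
proof -
  have Fx: "F x \<in> A \<times> B" "snd (F x) \<in> B" using S by auto
  have fd: "\<exists>B :: 'f set. finite B \<and> span B = UNIV"
    using inner_form.finite_dim[OF V.form[OF Fx(2)]] .
  have F1: "Ck_on (Suc (Suc 0)) S F" using F by (simp add: numeral_2_eq_2)
  have f1: "Ck_on (Suc (Suc 0)) B f" using f by (simp add: numeral_2_eq_2)
  have F2: "Ck_on 2 S (\<lambda>z. snd (F z))"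
    using bounded_linear_snd S(1) F by (rule Ck_on_bounded_linear)
  have im: "(\<lambda>z. snd (F z)) ` S \<subseteq> B" using S(3) by force
  have d1: "deriv_at (\<lambda>z. snd (F z)) y v = snd (deriv_at F y v)" if "y \<in> S" for y v
    using frechet_derivative_at[OF bounded_linear.has_derivative[OF bounded_linear_snd
      Ck_on_has_derivative[OF F1 S(1) that]]] by (simp add: fun_eq_iff)
  have "((\<lambda>y. deriv_at (\<lambda>z. snd (F z)) y u) has_derivative
      (\<lambda>w. snd (deriv_at (\<lambda>y. deriv_at F y u) x w))) (at x)"
    by (rule has_derivative_transform_within_open[OF bounded_linear.has_derivative[OF bounded_linear_snd
          Ck_on_has_derivative[OF Ck_on_deriv[OF F1 S(1)] S(1,2)]] S(1,2)]) (simp add: d1)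
  from frechet_derivative_at[OF this]
  have d2: "deriv_at (\<lambda>y. deriv_at (\<lambda>z. snd (F z)) y u) x u = snd (deriv_at (\<lambda>y. deriv_at F y u) x u)"
    by (simp add: fun_eq_iff)
  note comp = second_derivative_compose[OF fd S(1,2) V.open_dom im F2 f]
  show ?grad using comp(2) d1[OF S(2)] by simp
  let ?u2 = "snd (deriv_at F x u)" and ?S = "local_sff (warped_metric a p b) F x u u"
    and ?r = "2 * deriv_at p (fst (F x)) (fst (deriv_at F x u)) / p (fst (F x))"
  have L: "linear (deriv_at f (snd (F x)))"
    by (rule has_derivative_linear[OF Ck_on_has_derivative[OF f1 V.open_dom Fx(2)]])
  have "snd (deriv_at (\<lambda>y. deriv_at F y u) x u) + christoffel b (snd (F x)) ?u2 ?u2 + ?r *\<^sub>R ?u2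
      = snd ?S + snd (deriv_at F x (christoffel m x u u))"
    using arg_cong[OF W.gauss_formula[OF S F m, of u], of snd]
    by (simp add: local_cov_deriv_def snd_christoffel_warped[OF Fx(1)] add.assoc)
  then have "snd (deriv_at (\<lambda>y. deriv_at F y u) x u) - snd (deriv_at F x (christoffel m x u u))
      = snd ?S - christoffel b (snd (F x)) ?u2 ?u2 - ?r *\<^sub>R ?u2"
    by (simp add: algebra_simps)
  from arg_cong[OF this, of "deriv_at f (snd (F x))"]
  show ?hess
    unfolding local_hess_def comp d1[OF S(2)] d2
    by (simp add: linear_diff[OF L] linear_cmul[OF L])
qed

end


section \<open>Derivative bounds\<close>

lemma deriv_at_cong:
  assumes "open S" "x \<in> S" "\<And>y. y \<in> S \<Longrightarrow> f y = g y"
  shows "deriv_at f x = deriv_at g x"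
proof -
  have "(f has_derivative f') (at x) \<longleftrightarrow> (g has_derivative f') (at x)" for f'
    using assms has_derivative_transform_within_open[OF _ assms(1,2)] by metis
  then show ?thesis by (simp add: frechet_derivative_def)
qed

lemma local_hess_cong:
  assumes "open S" "x \<in> S" "\<And>y. y \<in> S \<Longrightarrow> f y = f' y"
  shows "local_hess g f x u v = local_hess g f' x u v"
proof -
  have eq: "deriv_at f y = deriv_at f' y" if "y \<in> S" for y
    by (rule deriv_at_cong[OF assms(1) that assms(3)])
  then have "deriv_at (\<lambda>y. deriv_at f y v) x = deriv_at (\<lambda>y. deriv_at f' y v) x"
    by (intro deriv_at_cong[OF assms(1,2)]) simp
  then show ?thesis by (simp add: local_hess_def eq assms(2))
qed

lemma (in inner_form) riesz_bound:
  assumes "linear f"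
  shows "f w \<le> sqrt (b (THE z. \<forall>w. b z w = f w) (THE z. \<forall>w. b z w = f w)) * sqrt (b w w)"
  using cauchy_schwarz riesz_the[OF assms] by metis

text \<open>Evaluating \<open>f\<close> at its own representing vector z gives |z|^2 <= k |z|.
  Together with \<open>riesz_bound\<close> this makes the length of a gradient the dual norm of the
  derivative.\<close>

lemma (in inner_form) riesz_norm_le:
  assumes f: "linear f" and k: "k \<ge> 0" "\<And>w. f w \<le> k * sqrt (b w w)"
  shows "sqrt (b (THE z. \<forall>w. b z w = f w) (THE z. \<forall>w. b z w = f w)) \<le> k"
proof -
  let ?z = "THE z. \<forall>w. b z w = f w"
  have "sqrt (b ?z ?z) * sqrt (b ?z ?z) \<le> k * sqrt (b ?z ?z)"
    using k(2)[of ?z] real_sqrt_mult_self[of "b ?z ?z"] nonneg[of ?z] riesz_the[OF f, of ?z]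
    by linarith
  then show ?thesis
    using k(1) nonneg[of ?z]
    by (cases "b ?z ?z = 0") (auto simp del: real_sqrt_mult_self nonneg intro: mult_right_le_imp_le)
qed

text \<open>Near \<open>x\<close> the Gram matrix of a \<open>g x\<close>-orthonormal basis is close to the identity, so that
  \<open>g y\<close> dominates a multiple of the squared sum of the coefficients in that basis.\<close>

lemma (in coord_metric) derivative_bound:
  fixes f :: "'e \<Rightarrow> real"
  assumes f: "Ck_on 1 U f" and x: "x \<in> U"
  shows "\<exists>C T. open T \<and> x \<in> T \<and> T \<subseteq> U \<and> (\<forall>y\<in>T. \<forall>u. \<bar>deriv_at f y u\<bar> \<le> C * sqrt (g y u u))"
proof -
  have f1: "Ck_on (Suc 0) U f" using f by simp
  interpret x: inner_form "g x" using x by (rule form)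
  obtain E where E: "orthonormal_basis (g x) E" using x.orthonormal_basis_exists by blast
  note fin = x.finite_orthonormal_basis[OF E]
  \<comment> \<open>\<open>N\<close> bounds the number of basis vectors and is positive even in
    dimension 0. For the coefficient sum \<open>s\<close>, Cauchy-Schwarz gives s^2 <= N * g x u u.
    Entries varying by less than 1 / (2 N) change the form by at most s^2 / (2 N), so g y u u keeps
    the lower bound s^2 / (2 N).\<close>
  define N where "N = real (card E) + 1"
  have N: "N > 0" by (simp add: N_def add_nonneg_pos)
  \<comment> \<open>A common bound near \<open>x\<close> for the derivative on all basis vectors;
    the 1 absorbs the variation allowed in \<open>ev1\<close>.\<close>
  define D where "D = (\<Sum>e\<in>E. \<bar>deriv_at f x e\<bar> + 1)"
  have D0: "D \<ge> 0" unfolding D_def by (intro sum_nonneg) simp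
  have "isCont (\<lambda>y. deriv_at f y e) x" for e
    using Ck_on_deriv[OF f1 open_dom, of e] x open_dom by (simp add: continuous_on_eq_continuous_at)
  then have "\<forall>\<^sub>F y in nhds x. dist (deriv_at f y e) (deriv_at f x e) < 1" for e
    by (intro tendstoD) (simp_all add: isCont_def tendsto_nhds_iff)
  then have ev1: "\<forall>\<^sub>F y in nhds x. \<forall>e\<in>E. dist (deriv_at f y e) (deriv_at f x e) < 1"
    using fin by (simp add: eventually_ball_finite_distrib)
  have "isCont (\<lambda>y. g y e e') x" for e e'
    using has_derivative_continuous[OF has_derivative[OF x]] .
  then have "\<forall>\<^sub>F y in nhds x. dist (g y e e') (g x e e') < 1 / (2 * N)" for e e'
    using N by (intro tendstoD) (simp_all add: isCont_def tendsto_nhds_iff)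
  then have ev2: "\<forall>\<^sub>F y in nhds x. \<forall>e\<in>E. \<forall>e'\<in>E. dist (g y e e') (g x e e') < 1 / (2 * N)"
    using fin by (simp add: eventually_ball_finite_distrib)
  have "\<forall>\<^sub>F y in nhds x. y \<in> U" using open_dom x by (rule eventually_nhds_in_open)
  with ev1 ev2 have "\<forall>\<^sub>F y in nhds x. y \<in> U \<and> (\<forall>e\<in>E. dist (deriv_at f y e) (deriv_at f x e) < 1)
      \<and> (\<forall>e\<in>E. \<forall>e'\<in>E. dist (g y e e') (g x e e') < 1 / (2 * N))"
    by eventually_elim blast
  then obtain T where T: "open T" "x \<in> T" "\<And>y. y \<in> T \<Longrightarrow> y \<in> U"
    "\<And>y e. y \<in> T \<Longrightarrow> e \<in> E \<Longrightarrow> dist (deriv_at f y e) (deriv_at f x e) < 1"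
    "\<And>y e e'. y \<in> T \<Longrightarrow> e \<in> E \<Longrightarrow> e' \<in> E \<Longrightarrow> dist (g y e e') (g x e e') < 1 / (2 * N)"
    unfolding eventually_nhds by blast
  have "\<bar>deriv_at f y u\<bar> \<le> D * sqrt (2 * N) * sqrt (g y u u)" if y: "y \<in> T" for y u
  proof -
    interpret y: inner_form "g y" using T(3)[OF y] by (rule form)
    define s where "s = (\<Sum>e\<in>E. \<bar>g x u e\<bar>)"
    have s0: "s \<ge> 0" unfolding s_def by (intro sum_nonneg) simp
    have bd: "\<bar>deriv_at f y e\<bar> \<le> D" if "e \<in> E" for e
    proof -
      have "\<bar>deriv_at f y e\<bar> \<le> \<bar>deriv_at f x e\<bar> + 1"
        using T(4)[OF y that] by (simp add: dist_real_def)
      also have "\<dots> \<le> D" unfolding D_def using fin that by (intro member_le_sum) auto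
      finally show ?thesis .
    qed
    have "\<bar>deriv_at f y u\<bar> = \<bar>\<Sum>e\<in>E. g x u e *\<^sub>R deriv_at f y e\<bar>"
      by (rule arg_cong[where f = abs, OF x.linear_expansion[OF E
            has_derivative_linear[OF Ck_on_has_derivative[OF f1 open_dom T(3)[OF y]]]]])
    also have "\<dots> \<le> (\<Sum>e\<in>E. \<bar>g x u e\<bar> * D)"
      by (rule order_trans[OF sum_abs]) (auto simp: abs_mult intro!: sum_mono mult_left_mono bd)
    also have "\<dots> = D * s" by (simp add: s_def sum_distrib_left mult.commute)
    finally have df: "\<bar>deriv_at f y u\<bar> \<le> D * s" .
    have "s\<^sup>2 = (\<Sum>e\<in>E. \<bar>g x u e\<bar> * 1)\<^sup>2" by (simp add: s_def)
    also have "\<dots> \<le> (\<Sum>e\<in>E. \<bar>g x u e\<bar>\<^sup>2) * (\<Sum>e\<in>E. 1\<^sup>2)" by (rule Cauchy_Schwarz_ineq_sum)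
    also have "\<dots> \<le> g x u u * N"
      unfolding x.norm_expansion[OF E, of u] power2_abs
      by (intro mult_left_mono sum_nonneg) (simp_all add: N_def)
    finally have s2: "s\<^sup>2 \<le> g x u u * N" .
    have exy: "g z u u = (\<Sum>e\<in>E. \<Sum>e'\<in>E. g x u e * (g x u e' * g z e e'))" if "inner_form (g z)" for z
    proof -
      interpret z: inner_form "g z" by (rule that)
      have "g z u u = (\<Sum>e\<in>E. g x u e *\<^sub>R g z e u)"
        by (rule x.linear_expansion[OF E z.linear_left])
      also have "\<dots> = (\<Sum>e\<in>E. g x u e *\<^sub>R (\<Sum>e'\<in>E. g x u e' *\<^sub>R g z e e'))"
        using x.linear_expansion[OF E z.linear_right] by metis
      finally show ?thesis by (simp add: sum_distrib_left)
    qed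
    have "g x u u - g y u u
        = (\<Sum>e\<in>E. \<Sum>e'\<in>E. g x u e * (g x u e' * g x e e')) - (\<Sum>e\<in>E. \<Sum>e'\<in>E. g x u e * (g x u e' * g y e e'))"
      by (rule arg_cong2[where f = "(-)", OF exy[OF x.inner_form_axioms] exy[OF y.inner_form_axioms]])
    also have "\<dots> = (\<Sum>e\<in>E. \<Sum>e'\<in>E. g x u e * (g x u e' * (g x e e' - g y e e')))"
      by (simp add: sum_subtractf right_diff_distrib)
    also have "\<dots> \<le> (\<Sum>e\<in>E. \<Sum>e'\<in>E. \<bar>g x u e\<bar> * (\<bar>g x u e'\<bar> * (1 / (2 * N))))"
    proof (intro sum_mono)
      fix e e' assume "e \<in> E" "e' \<in> E"
      then have "\<bar>g x e e' - g y e e'\<bar> \<le> 1 / (2 * N)"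
        using T(5)[OF y] by (simp add: dist_real_def abs_minus_commute less_imp_le)
      then have "\<bar>g x u e * (g x u e' * (g x e e' - g y e e'))\<bar> \<le> \<bar>g x u e\<bar> * (\<bar>g x u e'\<bar> * (1 / (2 * N)))"
        unfolding abs_mult by (intro mult_left_mono) auto
      then show "g x u e * (g x u e' * (g x e e' - g y e e')) \<le> \<bar>g x u e\<bar> * (\<bar>g x u e'\<bar> * (1 / (2 * N)))"
        by linarith
    qed
    also have "\<dots> = s\<^sup>2 / (2 * N)"
      by (simp add: s_def power2_eq_square sum_product sum_divide_distrib)
    finally have "g x u u - g y u u \<le> s\<^sup>2 / (2 * N)" .
    moreover have "s\<^sup>2 / N \<le> g x u u" using s2 N by (simp add: field_simps)
    ultimately have "s\<^sup>2 / (2 * N) \<le> g y u u" using N by (simp add: field_simps)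
    then have "s\<^sup>2 \<le> 2 * N * g y u u" using N by (simp add: field_simps)
    then have "s \<le> sqrt (2 * N) * sqrt (g y u u)"
      using real_le_rsqrt by (simp add: real_sqrt_mult[symmetric])
    then have "D * s \<le> D * (sqrt (2 * N) * sqrt (g y u u))" using D0 by (rule mult_left_mono)
    then show ?thesis using df by simp
  qed
  then show ?thesis using T(1-3) by (intro exI[of _ "D * sqrt (2 * N)"] exI[of _ T]) auto
qed


section \<open>Charts\<close>

locale riem_chart =
  fixes N :: "('a, 'i, 'e::real_inner) riem" and i :: 'i
  assumes manifold: "riemannian_manifold N" and chart: "i \<in> index N"
begin

abbreviation "img \<equiv> coord N i ` cdom N i"

lemma openin_cdom: "openin (points N) (cdom N i)"
  and open_img: "open img"
  and homeo: "homeomorphic_map (subtopology (points N) (cdom N i)) (top_of_set img) (coord N i)"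
  using manifold chart unfolding riemannian_manifold_def smooth_atlas_def by auto

lemma cdom_subset: "cdom N i \<subseteq> carr N"
  using openin_cdom openin_subset unfolding carr_def by blast

lemma inj_coord: "inj_on (coord N i) (cdom N i)"
  using homeomorphic_imp_injective_map[OF homeo] cdom_subset
  by (simp add: carr_def Int_absorb1)

lemma chart_inv_coord: "p \<in> cdom N i \<Longrightarrow> chart_inv N i (coord N i p) = p"
  unfolding chart_inv_def by (rule inv_into_f_f[OF inj_coord])

lemma openin_preimage:
  assumes "open T"
  shows "openin (points N) {p \<in> cdom N i. coord N i p \<in> T}"
proof -
  have "openin (top_of_set img) (T \<inter> img)" using assms by (auto simp: openin_subtopology)
  then have "openin (subtopology (points N) (cdom N i))
      {p \<in> topspace (subtopology (points N) (cdom N i)). coord N i p \<in> T \<inter> img}"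
    using homeomorphic_imp_continuous_map[OF homeo] openin_continuous_map_preimage by blast
  moreover have "{p \<in> topspace (subtopology (points N) (cdom N i)). coord N i p \<in> T \<inter> img}
      = {p \<in> cdom N i. coord N i p \<in> T}"
    using cdom_subset by (auto simp: carr_def)
  ultimately show ?thesis using openin_cdom openin_trans_full by metis
qed

lemma open_image:
  assumes "openin (points N) P" "P \<subseteq> cdom N i"
  shows "open (coord N i ` P)"
proof -
  have "openin (subtopology (points N) (cdom N i)) P"
    using assms openin_cdom by (simp add: openin_open_subtopology)
  then have "openin (top_of_set img) (coord N i ` P)"
    using homeomorphic_imp_open_map[OF homeo] unfolding open_map_def by blast
  then show ?thesis using open_img openin_open_trans by blast
qed

sublocale coord_metric "gcomp N i" img
proof (rule coord_metric.intro)
  have fd: "\<exists>B :: 'e set. finite B \<and> span B = UNIV"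
    using manifold unfolding riemannian_manifold_def smooth_atlas_def by blast
  have "riemannian_metric N" using manifold unfolding riemannian_manifold_def by blast
  note g = this[unfolded riemannian_metric_def, THEN conjunct1, THEN bspec, OF chart]
  show "open img" by (rule open_img)
  show "inner_form (gcomp N i y)" if "y \<in> img" for y
  proof (rule inner_form.intro)
    note y = bspec[OF g[THEN conjunct1] that]
    show "linear (gcomp N i y u)" for u by (rule y[THEN conjunct1, THEN spec])
    show "gcomp N i y u v = gcomp N i y v u" for u v
      by (rule y[THEN conjunct2, THEN conjunct1, THEN spec, THEN spec])
    show "u \<noteq> 0 \<Longrightarrow> gcomp N i y u u > 0" for u
      by (rule y[THEN conjunct2, THEN conjunct2, THEN spec, THEN mp])
  qed (rule fd)
  show "(\<lambda>z. gcomp N i z u v) differentiable (at y)" if "y \<in> img" for y u v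
  proof -
    have "smooth_on img (\<lambda>z. gcomp N i z u v)"
      by (rule g[THEN conjunct2, THEN spec, THEN spec])
    then have "Ck_on (Suc 0) img (\<lambda>z. gcomp N i z u v)" unfolding smooth_on_def by blast
    from Ck_on_has_derivative[OF this open_img that] show ?thesis by (auto simp: differentiable_def)
  qed
qed

lemma Ck_on_smooth_function:
  "smooth_function N f \<Longrightarrow> Ck_on k img (f \<circ> chart_inv N i)"
  using chart unfolding smooth_function_def smooth_on_def by blast

lemma deriv_at_bound_grad:
  assumes "smooth_function N f" "p \<in> cdom N i"
  shows "deriv_at (f \<circ> chart_inv N i) (coord N i p) w \<le> tnorm N p i (grad N f p i) * tnorm N p i w"
proof -
  have x: "coord N i p \<in> img" using assms(2) by blast
  have "linear (deriv_at (f \<circ> chart_inv N i) (coord N i p))"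
    by (rule has_derivative_linear[OF Ck_on_has_derivative[OF Ck_on_smooth_function[OF assms(1)] open_img x]])
  from inner_form.riesz_bound[OF form[OF x] this] show ?thesis
    unfolding tnorm_def local_norm_def grad_def local_grad_def .
qed

end

lemma riem_chartI: "riemannian_manifold N \<Longrightarrow> i \<in> charts_at N p \<Longrightarrow> riem_chart N i"
  by (simp add: riem_chart_def charts_at_def)

lemma charts_at_nonempty:
  assumes "riemannian_manifold N" "p \<in> carr N"
  obtains i where "i \<in> charts_at N p"
proof -
  have "(\<Union>i\<in>index N. cdom N i) = carr N"
    using assms(1) unfolding riemannian_manifold_def smooth_atlas_def by blast
  then show ?thesis using assms(2) that unfolding charts_at_def by blast
qed

text \<open>The chart is allowed to depend on the point, which avoids any change of coordinates.\<close>

lemma warping_bounds_on_compact: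
  assumes N: "riemannian_manifold N" and f: "smooth_function N f" "\<forall>p \<in> carr N. f p > 0"
    and K: "compactin (points N) K"
  shows "\<exists>C>0. \<forall>p\<in>K. \<exists>i\<in>charts_at N p. 1 / f p \<le> C \<and>
    (\<forall>u. \<bar>deriv_at (f \<circ> chart_inv N i) (coord N i p) u\<bar> \<le> C * tnorm N p i u)"
proof -
  define good where "good = (\<lambda>C p. \<exists>i\<in>charts_at N p. 1 / f p \<le> C \<and>
    (\<forall>u. \<bar>deriv_at (f \<circ> chart_inv N i) (coord N i p) u\<bar> \<le> C * tnorm N p i u))"
  have tnorm_nonneg: "tnorm N p i u \<ge> 0" if "i \<in> charts_at N p" for p i u
  proof -
    interpret riem_chart N i using riem_chartI[OF N that] .
    have "coord N i p \<in> img" using that by (simp add: charts_at_def)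
    from inner_form.nonneg[OF form[OF this]] show ?thesis by (simp add: tnorm_def local_norm_def)
  qed
  \<comment> \<open>Norms are nonnegative, so constants may be enlarged; this is what lets finitely
    many local constants be replaced by one.\<close>
  have mono: "good C' p" if "good C p" "C \<le> C'" for C C' p
    using that tnorm_nonneg unfolding good_def
    by (meson mult_right_mono order_trans)
  have "\<exists>P C. openin (points N) P \<and> p \<in> P \<and> (\<forall>q\<in>P. good C q)" if p: "p \<in> carr N" for p
  proof -
    obtain i where i: "i \<in> charts_at N p" using charts_at_nonempty[OF N p] .
    then have ip: "p \<in> cdom N i" by (simp add: charts_at_def)
    interpret riem_chart N i using riem_chartI[OF N i] .
    let ?f = "f \<circ> chart_inv N i" and ?x = "coord N i p"
    have x: "?x \<in> img" using ip by blast
    obtain C T where T: "open T" "?x \<in> T" "T \<subseteq> img"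
      "\<And>y u. y \<in> T \<Longrightarrow> \<bar>deriv_at ?f y u\<bar> \<le> C * sqrt (gcomp N i y u u)"
      using derivative_bound[OF Ck_on_smooth_function[OF f(1)] x] by blast
    have fp: "f p > 0" using f(2) p by blast
    have "isCont ?f ?x"
      using has_derivative_continuous[OF Ck_on_has_derivative[OF Ck_on_smooth_function[OF f(1)] open_img x]] .
    then have "(?f \<longlongrightarrow> f p) (nhds ?x)"
      by (simp add: isCont_def tendsto_nhds_iff chart_inv_coord ip)
    then have "\<forall>\<^sub>F y in nhds ?x. f p / 2 < ?f y" 
      by (rule order_tendstoD(1)) (use fp in simp)
    then obtain T' where T': "open T'" "?x \<in> T'" "\<And>y. y \<in> T' \<Longrightarrow> f p / 2 < ?f y"
      unfolding eventually_nhds by blast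
    define P where "P = {q \<in> cdom N i. coord N i q \<in> T \<inter> T'}"
    \<comment> \<open>The entry 2 / f p comes from f > f p / 2 on \<open>T'\<close>, the entry
      \<open>C\<close> from the derivative bound on \<open>T\<close>.\<close>
    have "good (max C (2 / f p)) q" if "q \<in> P" for q
      unfolding good_def
    proof (intro bexI conjI allI)
      show iq: "i \<in> charts_at N q" using that chart by (simp add: P_def charts_at_def)
      have "f p / 2 < f q" using T'(3)[of "coord N i q"] that by (simp add: P_def chart_inv_coord)
      then have "1 / f q \<le> 2 / f p" using fp by (simp add: field_simps)
      then show "1 / f q \<le> max C (2 / f p)" by simp
      fix u
      have "\<bar>deriv_at ?f (coord N i q) u\<bar> \<le> C * tnorm N q i u"
        using T(4)[of "coord N i q"] that by (simp add: P_def tnorm_def local_norm_def)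
      also have "\<dots> \<le> max C (2 / f p) * tnorm N q i u"
        using tnorm_nonneg[OF iq] by (intro mult_right_mono) auto
      finally show "\<bar>deriv_at ?f (coord N i q) u\<bar> \<le> max C (2 / f p) * tnorm N q i u" .
    qed
    moreover have "openin (points N) P" unfolding P_def by (intro openin_preimage open_Int T T')
    moreover have "p \<in> P" using ip T T' by (simp add: P_def)
    ultimately show ?thesis by blast
  qed
  then obtain P C where P: "\<And>p. p \<in> carr N \<Longrightarrow> openin (points N) (P p) \<and> p \<in> P p \<and> (\<forall>q\<in>P p. good (C p) q)"
    by metis
  have KN: "K \<subseteq> carr N" using K by (simp add: carr_def compactin_subset_topspace)
  have "\<exists>\<F>. finite \<F> \<and> \<F> \<subseteq> P ` K \<and> K \<subseteq> \<Union>\<F>"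
    using compactinD[OF K, of "P ` K"] P KN by blast
  then obtain L where L: "finite L" "L \<subseteq> K" "K \<subseteq> (\<Union>p\<in>L. P p)"
    by (metis finite_subset_image)
  \<comment> \<open>Absolute values make every summand at most the whole sum; the added 1 gives
    positivity also when \<open>L\<close> is empty.\<close>
  define C' where "C' = (\<Sum>p\<in>L. \<bar>C p\<bar>) + 1"
  have "good C' q" if q: "q \<in> K" for q
  proof -
    obtain p where p: "p \<in> L" "q \<in> P p" using L(3) q by blast
    then have "good (C p) q" using P L KN by blast
    moreover have "\<bar>C p\<bar> \<le> (\<Sum>p\<in>L. \<bar>C p\<bar>)" using L p by (intro member_le_sum) auto
    ultimately show ?thesis using mono unfolding C'_def by (smt (verit))
  qed
  moreover have "C' > 0" unfolding C'_def by (intro add_nonneg_pos sum_nonneg) auto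
  ultimately show ?thesis unfolding good_def by blast
qed

text \<open>Over the compact factor \<open>K\<close> the projection to \<open>Y\<close> is closed
  with compact fibres, hence proper. As \<phi> takes values over \<open>K\<close>, the map is a
  composite of three proper maps.\<close>

lemma proper_map_snd_compose:
  assumes \<phi>: "proper_map Z (prod_topology X Y) \<phi>"
    and K: "compactin X K" "fst ` \<phi> ` topspace Z \<subseteq> K"
    and g: "proper_map Y T g"
  shows "proper_map Z T (g \<circ> snd \<circ> \<phi>)"
proof -
  have KX: "K \<subseteq> topspace X" using K(1) by (rule compactin_subset_topspace)
  have "\<phi> \<in> topspace Z \<rightarrow> K \<times> topspace Y"
    using proper_map_imp_subset_topspace[OF \<phi>] K(2) by (fastforce simp: image_subset_iff Pi_iff)
  then have "proper_map Z (subtopology (prod_topology X Y) (K \<times> topspace Y)) \<phi>"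
    using \<phi> by (intro proper_map_into_subtopology)
  then have 1: "proper_map Z (prod_topology (subtopology X K) Y) \<phi>"
    by (simp add: subtopology_Times)
  have cs: "compact_space (subtopology X K)" using K(1) by (simp add: compactin_subspace)
  have "compactin (prod_topology (subtopology X K) Y)
      {z \<in> topspace (prod_topology (subtopology X K) Y). snd z = y}" if "y \<in> topspace Y" for y
  proof -
    have "{z \<in> topspace (prod_topology (subtopology X K) Y). snd z = y} = K \<times> {y}"
      using that KX by auto
    moreover have "compactin (subtopology X K) K" using K(1) by (simp add: compactin_subtopology)
    ultimately show ?thesis using that by (simp add: compactin_Times)
  qed
  then have 2: "proper_map (prod_topology (subtopology X K) Y) Y snd"
    using Abstract_Topological_Spaces.closed_map_snd[OF cs] by (simp add: proper_map_def)
  show ?thesis using proper_map_compose[OF proper_map_compose[OF 1 2] g] by (simp add: o_assoc)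
qed


lemma coord_metric_subset:
  assumes "coord_metric g U" "open S" "S \<subseteq> U"
  shows "coord_metric g S"
  using assms unfolding coord_metric_def by blast

lemma warped_product_sel:
  "points (warped_product X \<psi> V) = prod_topology (points X) (points V)"
  "index (warped_product X \<psi> V) = index X \<times> index V"
  "cdom (warped_product X \<psi> V) (a, b) = cdom X a \<times> cdom V b"
  "coord (warped_product X \<psi> V) (a, b) z = (coord X a (fst z), coord V b (snd z))"
  "gcomp (warped_product X \<psi> V) (a, b) = warped_metric (gcomp X a) (\<psi> \<circ> chart_inv X a) (gcomp V b)"
  by (auto simp: warped_product_def warped_metric_def fun_eq_iff split: prod.splits)


section \<open>Immersions into warped products\<close>

locale warped_immersion =
  fixes X :: "('x, 'i, 'd::real_inner) riem" and V :: "('v, 'j, 'f::real_inner) riem"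
    and M :: "('m, 'k, 'e::real_inner) riem" and \<psi> :: "'x \<Rightarrow> real" and \<phi> :: "'m \<Rightarrow> 'x \<times> 'v"
  assumes manifolds: "riemannian_manifold X" "riemannian_manifold V" "riemannian_manifold M"
    and warping: "smooth_function X \<psi>" "\<forall>p \<in> carr X. \<psi> p > 0"
    and immersion: "isometric_immersion M (warped_product X \<psi> V) \<phi>"
begin

abbreviation "W \<equiv> warped_product X \<psi> V"

lemma continuous_immersion: "continuous_map (points M) (prod_topology (points X) (points V)) \<phi>"
  using immersion unfolding isometric_immersion_def smooth_map_def warped_product_sel by blast

lemma immersion_in_carr:
  assumes "p \<in> carr M"
  shows "fst (\<phi> p) \<in> carr X" "snd (\<phi> p) \<in> carr V"
proof -
  have "\<phi> p \<in> carr X \<times> carr V"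
    using continuous_map_funspace[OF continuous_immersion] assms by (auto simp: carr_def Pi_iff)
  then show "fst (\<phi> p) \<in> carr X" "snd (\<phi> p) \<in> carr V" by auto
qed

end

locale warped_immersion_chart = warped_immersion X V M \<psi> \<phi>
  for X :: "('x, 'i, 'd::real_inner) riem" and V :: "('v, 'j, 'f::real_inner) riem"
    and M :: "('m, 'k, 'e::real_inner) riem" and \<psi> :: "'x \<Rightarrow> real" and \<phi> :: "'m \<Rightarrow> 'x \<times> 'v" +
  fixes p i a b
  assumes i: "i \<in> charts_at M p" and a: "a \<in> charts_at X (fst (\<phi> p))" and b: "b \<in> charts_at V (snd (\<phi> p))"
begin

sublocale M: riem_chart M i by (rule riem_chartI[OF manifolds(3) i])
sublocale X: riem_chart X a by (rule riem_chartI[OF manifolds(1) a])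
sublocale V: riem_chart V b by (rule riem_chartI[OF manifolds(2) b])

text \<open>The chart \<open>i\<close> may reach beyond the part of \<open>M\<close> that \<phi>
  sends into the product chart. \<open>F\<close> expresses \<phi> in coordinates only on
  \<open>src\<close>, an open neighbourhood of the coordinates of \<open>p\<close>, which suffices
  for derivatives there.\<close>

definition "src = coord M i ` {q \<in> cdom M i. \<phi> q \<in> cdom W (a, b)}"
definition "F = local_expr M W \<phi> i (a, b)"

lemma chart_mem: "p \<in> cdom M i" "fst (\<phi> p) \<in> cdom X a" "snd (\<phi> p) \<in> cdom V b" "p \<in> carr M"
  using i a b M.cdom_subset by (auto simp: charts_at_def)

lemma index_mem: "i \<in> index M" "(a, b) \<in> index W"
  using i a b by (auto simp: charts_at_def warped_product_sel)

lemma chart_pair: "(a, b) \<in> charts_at W (\<phi> p)"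
  using a b by (auto simp: charts_at_def warped_product_sel mem_Times_iff)

lemma coord_mem: "coord M i p \<in> src" "coord X a (fst (\<phi> p)) \<in> X.img" "coord V b (snd (\<phi> p)) \<in> V.img"
  using chart_mem unfolding src_def by (auto simp: warped_product_sel mem_Times_iff)

lemma src_subset: "src \<subseteq> M.img"
  unfolding src_def by blast

lemma open_src: "open src"
proof -
  have "openin (prod_topology (points X) (points V)) (cdom W (a, b))"
    by (simp add: warped_product_sel openin_prod_Times_iff X.openin_cdom V.openin_cdom)
  then have "openin (points M) (cdom M i \<inter> {q \<in> topspace (points M). \<phi> q \<in> cdom W (a, b)})"
    using M.openin_cdom openin_continuous_map_preimage[OF continuous_immersion] by blast
  moreover have "cdom M i \<inter> {q \<in> topspace (points M). \<phi> q \<in> cdom W (a, b)}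
      = {q \<in> cdom M i. \<phi> q \<in> cdom W (a, b)}"
    using M.cdom_subset by (auto simp: carr_def)
  ultimately show ?thesis unfolding src_def by (intro M.open_image) auto
qed

lemma F_coord: "q \<in> cdom M i \<Longrightarrow> F (coord M i q) = (coord X a (fst (\<phi> q)), coord V b (snd (\<phi> q)))"
  by (simp add: F_def local_expr_def M.chart_inv_coord warped_product_sel)

lemma F_image: "F ` src \<subseteq> X.img \<times> V.img"
proof
  fix z assume "z \<in> F ` src"
  then obtain q where "q \<in> cdom M i" "\<phi> q \<in> cdom W (a, b)" "z = F (coord M i q)"
    unfolding src_def by blast
  then show "z \<in> X.img \<times> V.img" by (auto simp: F_coord warped_product_sel mem_Times_iff)
qed

lemma Ck_on_F: "Ck_on k src F"
proof -
  have "smooth_map M W \<phi>" using immersion unfolding isometric_immersion_def by (rule conjunct1)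
  then have "\<forall>i\<in>index M. \<forall>j\<in>index W.
      smooth_on (coord M i ` {q \<in> cdom M i. \<phi> q \<in> cdom W j}) (local_expr M W \<phi> i j)"
    unfolding smooth_map_def by (rule conjunct2)
  from bspec[OF bspec[OF this index_mem(1)] index_mem(2)] show ?thesis
    unfolding smooth_on_def src_def F_def by (rule spec)
qed

sublocale WC: warped_coord "gcomp X a" X.img "gcomp V b" V.img "\<psi> \<circ> chart_inv X a"
proof (intro warped_coord.intro warped_coord_axioms.intro)
  show "coord_metric (gcomp X a) X.img" by (rule X.coord_metric_axioms)
  show "coord_metric (gcomp V b) V.img" by (rule V.coord_metric_axioms)
  show "0 < (\<psi> \<circ> chart_inv X a) x" if "x \<in> X.img" for x
    using that warping(2) X.cdom_subset by (auto simp: X.chart_inv_coord)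
  show "(\<psi> \<circ> chart_inv X a) differentiable (at x)" if "x \<in> X.img" for x
    using Ck_on_has_derivative[OF X.Ck_on_smooth_function[OF warping(1)] X.open_img that]
    by (auto simp: differentiable_def)
qed

lemma immersion_metric:
  assumes "y \<in> src"
  shows "gcomp M i y u v = warped_metric (gcomp X a) (\<psi> \<circ> chart_inv X a) (gcomp V b) (F y)
    (deriv_at F y u) (deriv_at F y v)"
proof -
  obtain q where q: "q \<in> cdom M i" "\<phi> q \<in> cdom W (a, b)" "y = coord M i q"
    using assms unfolding src_def by blast
  have qc: "q \<in> carr M" "i \<in> charts_at M q" "(a, b) \<in> charts_at W (\<phi> q)"
    using q index_mem M.cdom_subset by (auto simp: charts_at_def)
  have "gcomp W (a, b) (coord W (a, b) (\<phi> q)) (differential M W \<phi> q i (a, b) u)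
      (differential M W \<phi> q i (a, b) v) = gcomp M i (coord M i q) u v"
    by (rule immersion[unfolded isometric_immersion_def, THEN conjunct2, THEN bspec, OF qc(1),
          THEN bspec, OF qc(2), THEN bspec, OF qc(3), THEN conjunct2, THEN spec, THEN spec])
  then show ?thesis
    using q by (simp add: F_coord warped_product_sel differential_def F_def[symmetric])
qed

lemma function_chart:
  assumes "y \<in> src"
  shows "(\<Gamma> \<circ> snd \<circ> \<phi> \<circ> chart_inv M i) y = (\<Gamma> \<circ> chart_inv V b) (snd (F y))"
proof -
  obtain q where "q \<in> cdom M i" "\<phi> q \<in> cdom W (a, b)" "y = coord M i q"
    using assms unfolding src_def by blast
  then show ?thesis
    by (auto simp: F_coord M.chart_inv_coord V.chart_inv_coord warped_product_sel mem_Times_iff)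
qed

lemma Ck_on_function:
  assumes "smooth_function V \<Gamma>"
  shows "Ck_on k src (\<Gamma> \<circ> snd \<circ> \<phi> \<circ> chart_inv M i)"
proof -
  have "Ck_on k src (\<lambda>y. (\<Gamma> \<circ> chart_inv V b) (snd (F y)))"
  proof (rule Ck_on_compose[where f = "\<Gamma> \<circ> chart_inv V b" and F = "\<lambda>y. snd (F y)"])
    show "\<exists>B :: 'f set. finite B \<and> span B = UNIV"
      using inner_form.finite_dim[OF V.form[OF coord_mem(3)]] .
    show "Ck_on k src (\<lambda>y. snd (F y))"
      by (rule Ck_on_bounded_linear[OF bounded_linear_snd open_src Ck_on_F])
    show "(\<lambda>y. snd (F y)) ` src \<subseteq> V.img" using F_image by force
    show "Ck_on k V.img (\<Gamma> \<circ> chart_inv V b)" by (rule V.Ck_on_smooth_function[OF assms])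
  qed (rule open_src V.open_img)+
  then show ?thesis using function_chart by (subst Ck_on_cong) auto
qed

definition "dF = deriv_at F (coord M i p)"

abbreviation "dfun \<Gamma> \<equiv> deriv_at (\<Gamma> \<circ> chart_inv V b) (coord V b (snd (\<phi> p)))"

lemma linear_dfun:
  assumes "smooth_function V \<Gamma>"
  shows "linear (dfun \<Gamma>)"
  by (rule has_derivative_linear[OF Ck_on_has_derivative[OF V.Ck_on_smooth_function[OF assms]
      V.open_img coord_mem(3)]])

lemma hess_pullback:
  assumes "smooth_function V \<Gamma>"
  shows "hess M (\<Gamma> \<circ> snd \<circ> \<phi>) p i e e = hess V \<Gamma> (snd (\<phi> p)) b (snd (dF e)) (snd (dF e))
      + dfun \<Gamma> (snd (second_fundamental_form M W \<phi> p i (a, b) e e))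
      - 2 * deriv_at (\<psi> \<circ> chart_inv X a) (coord X a (fst (\<phi> p))) (fst (dF e)) / \<psi> (fst (\<phi> p))
          * dfun \<Gamma> (snd (dF e))" (is ?hess)
    and "deriv_at (\<Gamma> \<circ> snd \<circ> \<phi> \<circ> chart_inv M i) (coord M i p) e = dfun \<Gamma> (snd (dF e))" (is ?deriv)
proof -
  have m: "coord_metric (gcomp M i) src"
    by (rule coord_metric_subset[OF M.coord_metric_axioms open_src src_subset])
  note H = WC.hess_warped_immersion[OF open_src coord_mem(1) F_image Ck_on_F
      V.Ck_on_smooth_function[OF assms] m immersion_metric]
  have "local_hess (gcomp M i) (\<Gamma> \<circ> snd \<circ> \<phi> \<circ> chart_inv M i) (coord M i p) e e
      = local_hess (gcomp M i) (\<lambda>z. (\<Gamma> \<circ> chart_inv V b) (snd (F z))) (coord M i p) e e"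
    by (rule local_hess_cong[OF open_src coord_mem(1) function_chart])
  also note H(1)
  finally show ?hess
    unfolding hess_def by (simp add: F_coord chart_mem dF_def second_fundamental_form_def
        F_def[symmetric] warped_product_sel X.chart_inv_coord)
  show ?deriv
    using trans[OF fun_cong[OF deriv_at_cong[where f = "\<Gamma> \<circ> snd \<circ> \<phi> \<circ> chart_inv M i",
          OF open_src coord_mem(1) function_chart]] H(2), of e]
    by (simp add: F_coord chart_mem dF_def)
qed

section \<open>Norm estimates at a point\<close>

lemma tnorm_dF: "tnorm W (\<phi> p) (a, b) (dF e) = tnorm M p i e"
  by (simp add: tnorm_def local_norm_def immersion_metric[OF coord_mem(1)] dF_def F_coord chart_mem
      warped_product_sel)

lemma tnorm_warped:
  "tnorm W (\<phi> p) (a, b) w = sqrt ((tnorm X (fst (\<phi> p)) a (fst w))\<^sup>2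
    + (\<psi> (fst (\<phi> p)) * tnorm V (snd (\<phi> p)) b (snd w))\<^sup>2)"
  using inner_form.nonneg[OF X.form[OF coord_mem(2)]] inner_form.nonneg[OF V.form[OF coord_mem(3)]]
  by (simp add: tnorm_def local_norm_def warped_product_sel warped_metric_apply power_mult_distrib
      X.chart_inv_coord chart_mem)

lemma tnorm_sq: "(tnorm M p i e)\<^sup>2 = gcomp M i (coord M i p) e e"
    "(tnorm V (snd (\<phi> p)) b v)\<^sup>2 = gcomp V b (coord V b (snd (\<phi> p))) v v"
  using inner_form.nonneg[OF M.form] inner_form.nonneg[OF V.form] coord_mem src_subset
  by (auto simp: tnorm_def local_norm_def)

lemma tnorm_nonneg: "tnorm M p i e \<ge> 0" "tnorm V (snd (\<phi> p)) b v \<ge> 0"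
    "tnorm X (fst (\<phi> p)) a u \<ge> 0"
  using inner_form.nonneg[OF M.form] inner_form.nonneg[OF V.form] inner_form.nonneg[OF X.form]
    coord_mem src_subset
  by (auto simp: tnorm_def local_norm_def)

lemma tnorm_fst_le: "tnorm X (fst (\<phi> p)) a (fst w) \<le> tnorm W (\<phi> p) (a, b) w"
  unfolding tnorm_warped by (rule real_le_rsqrt) simp

lemma tnorm_snd_le: "\<psi> (fst (\<phi> p)) * tnorm V (snd (\<phi> p)) b (snd w) \<le> tnorm W (\<phi> p) (a, b) w"
  unfolding tnorm_warped by (rule real_le_rsqrt) simp

lemma tnorm_snd_le_bound:
  assumes "1 / \<psi> (fst (\<phi> p)) \<le> C"
  shows "tnorm V (snd (\<phi> p)) b (snd w) \<le> C * tnorm W (\<phi> p) (a, b) w"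
proof -
  have \<psi>: "\<psi> (fst (\<phi> p)) > 0" using warping(2) immersion_in_carr chart_mem(4) by blast
  have "tnorm V (snd (\<phi> p)) b (snd w) \<le> (1 / \<psi> (fst (\<phi> p))) * tnorm W (\<phi> p) (a, b) w"
    using tnorm_snd_le[of w] \<psi> by (simp add: field_simps)
  also have "\<dots> \<le> C * tnorm W (\<phi> p) (a, b) w"
    using assms order_trans[OF tnorm_nonneg(3) tnorm_fst_le] by (rule mult_right_mono)
  finally show ?thesis .
qed

text \<open>In the application \<open>s\<close> is sqrt (\<gamma> p), so \<open>c * s\<close> is the
  gradient bound, and the factor \<open>C\<close> pays for the passage from lengths in
  \<open>V\<close> to lengths in \<open>W\<close>. The vector \<open>w\<close> may be an image of a
  tangent vector, a value of the second fundamental form or the mean curvature vector.\<close>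

lemma dfun_bound:
  assumes "smooth_function V \<Gamma>"
    and "tnorm V (snd (\<phi> p)) b (grad V \<Gamma> (snd (\<phi> p)) b) \<le> c * s" "c * s \<ge> 0"
    and "1 / \<psi> (fst (\<phi> p)) \<le> C"
  shows "dfun \<Gamma> (snd w) \<le> c * s * (C * tnorm W (\<phi> p) (a, b) w)"
proof -
  have "dfun \<Gamma> (snd w) \<le> c * s * tnorm V (snd (\<phi> p)) b (snd w)"
    using V.deriv_at_bound_grad[OF assms(1) chart_mem(3)] mult_right_mono[OF assms(2) tnorm_nonneg(2)]
      order_trans by blast
  also have "\<dots> \<le> c * s * (C * tnorm W (\<phi> p) (a, b) w)"
    by (intro mult_left_mono tnorm_snd_le_bound assms)
  finally show ?thesis .
qed

text \<open>The one-sided bound is used for \<open>w\<close> and \<open>- w\<close>. Absolute values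
  are needed for the warping term, a product whose factors have no definite sign.\<close>

lemma abs_dfun_bound:
  assumes "smooth_function V \<Gamma>"
    and "tnorm V (snd (\<phi> p)) b (grad V \<Gamma> (snd (\<phi> p)) b) \<le> c * s" "c * s \<ge> 0"
    and "1 / \<psi> (fst (\<phi> p)) \<le> C"
  shows "\<bar>dfun \<Gamma> (snd w)\<bar> \<le> c * s * (C * tnorm W (\<phi> p) (a, b) w)"
proof -
  have "tnorm W (\<phi> p) (a, b) (- w) = tnorm W (\<phi> p) (a, b) w"
    using inner_form.scale_left[OF WC.inner_form_warped, of _ "-1" w] inner_form.scale_right[OF WC.inner_form_warped, of _ _ "-1" w] coord_mem
    by (simp add: tnorm_def local_norm_def warped_product_sel)
  then show ?thesis
    using dfun_bound[OF assms, of w] dfun_bound[OF assms, of "- w"] linear_neg[OF linear_dfun[OF assms(1)]]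
    by simp
qed

lemma grad_pullback_bound:
  assumes "smooth_function V \<Gamma>"
    and "tnorm V (snd (\<phi> p)) b (grad V \<Gamma> (snd (\<phi> p)) b) \<le> c * s" "c * s \<ge> 0"
    and "1 / \<psi> (fst (\<phi> p)) \<le> C" "C \<ge> 0"
  shows "tnorm M p i (grad M (\<Gamma> \<circ> snd \<circ> \<phi>) p i) \<le> c * s * C"
proof -
  have x: "coord M i p \<in> M.img" using coord_mem src_subset by blast
  have "linear (deriv_at (\<Gamma> \<circ> snd \<circ> \<phi> \<circ> chart_inv M i) (coord M i p))"
    by (rule has_derivative_linear[OF Ck_on_has_derivative[OF Ck_on_function[OF assms(1)] open_src coord_mem(1)]])
  moreover have "deriv_at (\<Gamma> \<circ> snd \<circ> \<phi> \<circ> chart_inv M i) (coord M i p) w \<le> c * s * C * tnorm M p i w" for w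
    using dfun_bound[OF assms(1-4), of "dF w"] by (simp add: hess_pullback(2)[OF assms(1)] tnorm_dF mult.assoc)
  ultimately show ?thesis
    using inner_form.riesz_norm_le[OF M.form[OF x]] assms(3,5)
    unfolding tnorm_def local_norm_def grad_def local_grad_def by simp
qed

text \<open>The powers of \<open>C\<close> count the estimates: \<open>C\<^sup>2\<close> is the
  squared length of the vertical part of \<open>dF e\<close>, and \<open>C^3\<close> collects the
  derivative of \<psi>, the factor 1 / \<psi> and the derivative of \<Gamma>. The curvature term is
  kept as it stands, so that it can be either bounded or traced.\<close>

lemma hess_pullback_bound:
  assumes \<Gamma>: "smooth_function V \<Gamma>"
    and grad: "tnorm V (snd (\<phi> p)) b (grad V \<Gamma> (snd (\<phi> p)) b) \<le> c * s" "c * s \<ge> 0"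
    and hess: "\<And>v. hess V \<Gamma> (snd (\<phi> p)) b v v \<le> k * gcomp V b (coord V b (snd (\<phi> p))) v v" "k \<ge> 0"
    and C: "1 / \<psi> (fst (\<phi> p)) \<le> C" "C \<ge> 0"
    "\<And>u. \<bar>deriv_at (\<psi> \<circ> chart_inv X a) (coord X a (fst (\<phi> p))) u\<bar> \<le> C * tnorm X (fst (\<phi> p)) a u"
  shows "hess M (\<Gamma> \<circ> snd \<circ> \<phi>) p i e e \<le> (k * C\<^sup>2 + 2 * C^3 * (c * s)) * gcomp M i (coord M i p) e e
    + dfun \<Gamma> (snd (second_fundamental_form M W \<phi> p i (a, b) e e))"
proof -
  let ?n = "tnorm M p i e" and ?d = "deriv_at (\<psi> \<circ> chart_inv X a) (coord X a (fst (\<phi> p))) (fst (dF e))"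
  have \<psi>: "\<psi> (fst (\<phi> p)) > 0" using warping(2) immersion_in_carr chart_mem(4) by blast
  have "tnorm V (snd (\<phi> p)) b (snd (dF e)) \<le> C * ?n"
    using tnorm_snd_le_bound[OF C(1), of "dF e"] by (simp add: tnorm_dF)
  then have "(tnorm V (snd (\<phi> p)) b (snd (dF e)))\<^sup>2 \<le> (C * ?n)\<^sup>2"
    by (intro power_mono tnorm_nonneg)
  then have 1: "hess V \<Gamma> (snd (\<phi> p)) b (snd (dF e)) (snd (dF e)) \<le> k * (C * ?n)\<^sup>2"
    using hess(1)[of "snd (dF e)"] mult_left_mono[OF _ hess(2)] unfolding tnorm_sq by fastforce
  have "\<bar>?d\<bar> \<le> C * ?n"
    using C(3)[of "fst (dF e)"] mult_left_mono[OF tnorm_fst_le[of "dF e"] C(2)] by (simp add: tnorm_dF)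
  then have "\<bar>?d\<bar> * (1 / \<psi> (fst (\<phi> p))) \<le> C * ?n * C"
    using C(1,2) \<psi> tnorm_nonneg(1) by (intro mult_mono) auto
  moreover have "\<bar>dfun \<Gamma> (snd (dF e))\<bar> \<le> c * s * (C * ?n)"
    using abs_dfun_bound[OF \<Gamma> grad C(1), of "dF e"] by (simp add: tnorm_dF)
  ultimately have "(\<bar>?d\<bar> * (1 / \<psi> (fst (\<phi> p)))) * \<bar>dfun \<Gamma> (snd (dF e))\<bar> \<le> (C * ?n * C) * (c * s * (C * ?n))"
    using C(2) tnorm_nonneg(1) by (intro mult_mono[of "\<bar>?d\<bar> * (1 / \<psi> (fst (\<phi> p)))"]) auto
  then have "\<bar>?d / \<psi> (fst (\<phi> p)) * dfun \<Gamma> (snd (dF e))\<bar> \<le> C^3 * (c * s) * ?n\<^sup>2"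
    using \<psi> by (simp add: abs_mult power2_eq_square power3_eq_cube mult_ac)
  then have "- (2 * (?d / \<psi> (fst (\<phi> p)) * dfun \<Gamma> (snd (dF e)))) \<le> 2 * (C^3 * (c * s) * ?n\<^sup>2)"
    by linarith
  with 1 show ?thesis
    unfolding hess_pullback(1)[OF \<Gamma>] tnorm_sq(1)[symmetric]
    by (simp add: power_mult_distrib algebra_simps)
qed

lemma laplacian_pullback_bound:
  assumes \<Gamma>: "smooth_function V \<Gamma>"
    and hess: "\<And>e. hess M (\<Gamma> \<circ> snd \<circ> \<phi>) p i e e \<le> k * gcomp M i (coord M i p) e e
      + dfun \<Gamma> (snd (second_fundamental_form M W \<phi> p i (a, b) e e))"
  shows "laplacian M (\<Gamma> \<circ> snd \<circ> \<phi>) p i \<le> k * real (dim (UNIV :: 'e set))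
    + dfun \<Gamma> (snd (mean_curvature_vector M W \<phi> p i (a, b)))"
proof -
  have "coord M i p \<in> M.img" using coord_mem src_subset by blast
  then interpret m: inner_form "gcomp M i (coord M i p)" by (rule M.form)
  \<comment> \<open>Laplacian and mean curvature vector are traces for the same form, so the choice
    in \<open>metric_trace\<close> returns the same basis for both and the Hessian estimate can be
    summed term by term.\<close>
  define E where "E = (SOME E. orthonormal_basis (gcomp M i (coord M i p)) E)"
  have E: "orthonormal_basis (gcomp M i (coord M i p)) E"
    unfolding E_def by (rule someI_ex[OF m.orthonormal_basis_exists])
  have "laplacian M (\<Gamma> \<circ> snd \<circ> \<phi>) p i = (\<Sum>e\<in>E. hess M (\<Gamma> \<circ> snd \<circ> \<phi>) p i e e)"
    by (simp add: laplacian_def local_laplacian_def hess_def metric_trace_def E_def)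
  also have "\<dots> \<le> (\<Sum>e\<in>E. k * gcomp M i (coord M i p) e e
      + dfun \<Gamma> (snd (second_fundamental_form M W \<phi> p i (a, b) e e)))"
    by (intro sum_mono hess)
  also have "\<dots> = k * real (card E) + dfun \<Gamma> (snd (\<Sum>e\<in>E. second_fundamental_form M W \<phi> p i (a, b) e e))"
    using m.orthonormal[OF E]
    by (simp add: sum.distrib linear_sum[OF linear_dfun[OF \<Gamma>]] snd_sum)
  finally show ?thesis
    by (simp add: mean_curvature_vector_def metric_trace_def E_def[symmetric] m.card_orthonormal_basis[OF E])
qed

end


section \<open>Pulling back OY-pairs\<close>

text \<open>Supplies h (sqrt \<gamma>) >= h 0 > 0. At interior points the derivative within the half
  line is the ordinary one; at 0 only continuity enters.\<close>

lemma nondecreasing_on_half_line: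
  assumes h: "smooth_on {0..} h" and h': "\<forall>t\<ge>0. vector_derivative h (at t within {0..}) \<ge> 0"
    and t: "t \<ge> (0::real)"
  shows "h 0 \<le> (h t :: real)"
proof -
  have "Ck_on (Suc 0) {0..} h" using h unfolding smooth_on_def by blast
  then have d: "h differentiable_on {0..}" by simp
  show ?thesis
  proof (rule DERIV_nonneg_imp_increasing_open[OF t])
    show "continuous_on {0..t} h"
      using differentiable_imp_continuous_on[OF d] by (rule continuous_on_subset) auto
    fix s :: real assume s: "0 < s" "s < t"
    have at: "at s within {0..} = at s"
      using s by (intro at_within_interior) auto
    have "h differentiable (at s within {0..})" using d s unfolding differentiable_on_def by auto
    then have "(h has_vector_derivative vector_derivative h (at s)) (at s)"
      unfolding at using vector_derivative_works by blast
    moreover have "vector_derivative h (at s) \<ge> 0" using h' s at by (metis less_imp_le)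
    ultimately show "\<exists>y. (h has_real_derivative y) (at s) \<and> 0 \<le> y"
      using has_real_derivative_iff_has_vector_derivative by blast
  qed
qed

section \<open>Properties holding outside a compact set\<close>

lemma outside_compact_conj:
  assumes "outside_compact N P" "outside_compact N Q"
  shows "outside_compact N (\<lambda>p. P p \<and> Q p)"
proof -
  obtain C D where "compactin (points N) C" "compactin (points N) D"
    "\<forall>p \<in> carr N - C. P p" "\<forall>p \<in> carr N - D. Q p"
    using assms unfolding outside_compact_def by blast
  then show ?thesis
    unfolding outside_compact_def by (intro exI[of _ "C \<union> D"]) (auto simp: compactin_Un)
qed

lemma outside_compact_mono:
  assumes "outside_compact N P" "\<And>p. p \<in> carr N \<Longrightarrow> P p \<Longrightarrow> Q p"
  shows "outside_compact N Q"
  using assms unfolding outside_compact_def by blast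

context warped_immersion
begin

lemma smooth_function_pullback:
  assumes "smooth_function V \<Gamma>"
  shows "smooth_function M (\<Gamma> \<circ> snd \<circ> \<phi>)"
  unfolding smooth_function_def smooth_on_def
proof (intro ballI allI)
  fix i k assume i: "i \<in> index M"
  interpret M: riem_chart M i using manifolds(3) i by (simp add: riem_chart_def)
  show "Ck_on k (coord M i ` cdom M i) (\<Gamma> \<circ> snd \<circ> \<phi> \<circ> chart_inv M i)"
  proof (rule Ck_on_local[OF M.open_img])
    fix x assume "x \<in> M.img"
    then obtain p where p: "p \<in> cdom M i" "x = coord M i p" by blast
    then have pM: "p \<in> carr M" using M.cdom_subset by blast
    obtain a where a: "a \<in> charts_at X (fst (\<phi> p))"
      using charts_at_nonempty[OF manifolds(1) immersion_in_carr(1)[OF pM]] .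
    obtain b where b: "b \<in> charts_at V (snd (\<phi> p))"
      using charts_at_nonempty[OF manifolds(2) immersion_in_carr(2)[OF pM]] .
    interpret C: warped_immersion_chart X V M \<psi> \<phi> p i a b
      by unfold_locales (use i p a b in \<open>simp_all add: charts_at_def\<close>)
    show "\<exists>T. open T \<and> x \<in> T \<and> Ck_on k T (\<Gamma> \<circ> snd \<circ> \<phi> \<circ> chart_inv M i)"
      using C.open_src C.coord_mem(1) C.Ck_on_function[OF assms] p(2) by blast
  qed
qed

text \<open>The exceptional set in \<open>M\<close> is the preimage of \<open>K \<times> C\<close>,
  compact by properness. Since the first component always lies in \<open>K\<close>, a point outside
  this preimage has its second component outside \<open>C\<close>.\<close>

lemma outside_compact_pullback:
  assumes "proper_map (points M) (points W) \<phi>" "compactin (points X) K" "fst ` \<phi> ` carr M \<subseteq> K"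
    and "outside_compact V P"
  shows "outside_compact M (\<lambda>p. P (snd (\<phi> p)))"
proof -
  obtain C where C: "compactin (points V) C" "\<forall>p \<in> carr V - C. P p"
    using assms(4) unfolding outside_compact_def by blast
  have "compactin (points W) (K \<times> C)"
    using assms(2) C(1) by (simp add: warped_product_sel compactin_Times)
  then have "compactin (points M) {p \<in> topspace (points M). \<phi> p \<in> K \<times> C}"
    by (rule compactin_proper_map_preimage[OF assms(1)])
  moreover have "P (snd (\<phi> p))" if "p \<in> carr M - {p \<in> topspace (points M). \<phi> p \<in> K \<times> C}" for p
  proof -
    have "fst (\<phi> p) \<in> K" using that assms(3) by blast
    then have "snd (\<phi> p) \<notin> C" using that by (auto simp: carr_def mem_Times_iff)
    then show ?thesis using C(2) that immersion_in_carr(2) by blast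
  qed
  ultimately show ?thesis unfolding outside_compact_def by blast
qed

text \<open>The second conclusion prepares both cases of the theorem at once. \<open>D\<close>
  stands for the derivative of \<Gamma> on the vertical component; the cases need only its bound, so
  the charts of the factors can be forgotten.\<close>

lemma OY_pullback:
  assumes proper: "proper_map (points M) (points W) \<phi>"
    and K: "compactin (points X) K" "fst ` \<phi> ` carr M \<subseteq> K"
    and OY: "OY_pair_hessian V h \<Gamma>"
  defines "\<gamma> \<equiv> \<Gamma> \<circ> snd \<circ> \<phi>"
  shows "OY_common M h \<gamma>"
    and "\<exists>k l. k > 0 \<and> l > 0 \<and> outside_compact M (\<lambda>p. \<forall>i \<in> charts_at M p. \<exists>j \<in> charts_at W (\<phi> p).
      \<exists>D. (\<forall>w. D w \<le> l * sqrt (\<gamma> p) * tnorm W (\<phi> p) j w) \<and>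
        (\<forall>e. hess M \<gamma> p i e e \<le> k * sqrt (\<gamma> p * h (sqrt (\<gamma> p))) * gcomp M i (coord M i p) e e
          + D (second_fundamental_form M W \<phi> p i j e e)) \<and>
        laplacian M \<gamma> p i \<le> k * sqrt (\<gamma> p * h (sqrt (\<gamma> p))) + D (mean_curvature_vector M W \<phi> p i j))"
      (is ?bounds)
proof -
  have common: "OY_common V h \<Gamma>" using OY unfolding OY_pair_hessian_def by blast
  have \<Gamma>: "smooth_function V \<Gamma>" and \<Gamma>0: "\<forall>q\<in>carr V. \<Gamma> q \<ge> 0" and h0: "h 0 > 0"
    and hs: "smooth_on {0..} h" and h': "\<forall>t\<ge>0. vector_derivative h (at t within {0..}) \<ge> 0"
    and prop\<Gamma>: "proper_map (points V) (top_of_set {0..}) \<Gamma>"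
    using common unfolding OY_common_def by blast+
  have \<gamma>0: "\<gamma> p \<ge> 0" if "p \<in> carr M" for p
    using \<Gamma>0 immersion_in_carr(2)[OF that] by (simp add: \<gamma>_def)
  obtain c where c: "c > 0" "outside_compact V (\<lambda>q. \<forall>b \<in> charts_at V q.
      tnorm V q b (grad V \<Gamma> q b) \<le> c * sqrt (\<Gamma> q))"
    using common unfolding OY_common_def by blast
  obtain c' where c': "c' > 0" "outside_compact V (\<lambda>q. \<forall>b \<in> charts_at V q. \<forall>e.
      hess V \<Gamma> q b e e \<le> c' * sqrt (\<Gamma> q * h (sqrt (\<Gamma> q))) * gcomp V b (coord V b q) e e)"
    using OY unfolding OY_pair_hessian_def by blast
  have out: "outside_compact M (\<lambda>p. (\<forall>b \<in> charts_at V (snd (\<phi> p)).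
      tnorm V (snd (\<phi> p)) b (grad V \<Gamma> (snd (\<phi> p)) b) \<le> c * sqrt (\<gamma> p)) \<and>
      (\<forall>b \<in> charts_at V (snd (\<phi> p)). \<forall>e. hess V \<Gamma> (snd (\<phi> p)) b e e
        \<le> c' * sqrt (\<gamma> p * h (sqrt (\<gamma> p))) * gcomp V b (coord V b (snd (\<phi> p))) e e))"
    using outside_compact_pullback[OF proper K outside_compact_conj[OF c(2) c'(2)]]
    by (simp add: \<gamma>_def)
  obtain C where C: "C > 0" "\<And>x. x \<in> K \<Longrightarrow> \<exists>a\<in>charts_at X x. 1 / \<psi> x \<le> C \<and>
      (\<forall>u. \<bar>deriv_at (\<psi> \<circ> chart_inv X a) (coord X a x) u\<bar> \<le> C * tnorm X x a u)"
    using warping_bounds_on_compact[OF manifolds(1) warping K(1)] by blast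
  have charts: "\<exists>a b. warped_immersion_chart X V M \<psi> \<phi> p i a b \<and> 1 / \<psi> (fst (\<phi> p)) \<le> C \<and>
      (\<forall>u. \<bar>deriv_at (\<psi> \<circ> chart_inv X a) (coord X a (fst (\<phi> p))) u\<bar> \<le> C * tnorm X (fst (\<phi> p)) a u)"
    if p: "p \<in> carr M" and i: "i \<in> charts_at M p" for p i
  proof -
    have "fst (\<phi> p) \<in> K" using K(2) p by blast
    then obtain a where a: "a \<in> charts_at X (fst (\<phi> p))" "1 / \<psi> (fst (\<phi> p)) \<le> C"
      "\<forall>u. \<bar>deriv_at (\<psi> \<circ> chart_inv X a) (coord X a (fst (\<phi> p))) u\<bar> \<le> C * tnorm X (fst (\<phi> p)) a u"
      using C(2) by blast
    obtain b where b: "b \<in> charts_at V (snd (\<phi> p))"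
      using charts_at_nonempty[OF manifolds(2) immersion_in_carr(2)[OF p]] .
    have "warped_immersion_chart X V M \<psi> \<phi> p i a b"
      by unfold_locales (rule i a b)+
    then show ?thesis using a by blast
  qed
  have grad: "outside_compact M (\<lambda>p. \<forall>i \<in> charts_at M p.
      tnorm M p i (grad M \<gamma> p i) \<le> c * C * sqrt (\<gamma> p))"
  proof (rule outside_compact_mono[OF out], intro ballI)
    fix p i assume p: "p \<in> carr M" and i: "i \<in> charts_at M p"
      and b: "(\<forall>b \<in> charts_at V (snd (\<phi> p)).
      tnorm V (snd (\<phi> p)) b (grad V \<Gamma> (snd (\<phi> p)) b) \<le> c * sqrt (\<gamma> p)) \<and>
      (\<forall>b \<in> charts_at V (snd (\<phi> p)). \<forall>e. hess V \<Gamma> (snd (\<phi> p)) b e e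
        \<le> c' * sqrt (\<gamma> p * h (sqrt (\<gamma> p))) * gcomp V b (coord V b (snd (\<phi> p))) e e)"
    obtain a b where ab: "warped_immersion_chart X V M \<psi> \<phi> p i a b" "1 / \<psi> (fst (\<phi> p)) \<le> C"
      using charts[OF p i] by blast
    interpret P: warped_immersion_chart X V M \<psi> \<phi> p i a b by (rule ab(1))
    have "tnorm M p i (grad M \<gamma> p i) \<le> c * sqrt (\<gamma> p) * C"
      unfolding \<gamma>_def
      by (rule P.grad_pullback_bound[OF \<Gamma> _ _ ab(2)])
        (use b P.b c(1) C(1) \<gamma>0[OF p] in \<open>auto simp: \<gamma>_def\<close>)
    then show "tnorm M p i (grad M \<gamma> p i) \<le> c * C * sqrt (\<gamma> p)" by (simp add: mult_ac)
  qed
  have proper\<gamma>: "proper_map (points M) (top_of_set {0..}) \<gamma>"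
    unfolding \<gamma>_def
    using proper_map_snd_compose[OF _ K(1) _ prop\<Gamma>, of "points M" \<phi>] proper K(2)
    by (simp add: warped_product_sel carr_def)
  \<comment> \<open>The conditions on \<open>h\<close> alone carry over unchanged; smoothness, sign,
    properness and the gradient bound are the ones that involve \<open>M\<close>.\<close>
  show "OY_common M h \<gamma>"
    using common grad proper\<gamma> \<gamma>0 smooth_function_pullback[OF \<Gamma>] c(1) C(1)
    unfolding OY_common_def \<gamma>_def[symmetric] by (auto intro!: exI[of _ "c * C"])
  \<comment> \<open>The coefficient of \<open>hess_pullback_bound\<close> with sqrt (\<gamma> * h
    (sqrt \<gamma>)) factored out. The division by sqrt (h 0) comes from sqrt \<gamma> <= sqrt
    (\<gamma> * h (sqrt \<gamma>)) / sqrt (h 0).\<close>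
  define k0 where "k0 = c' * C\<^sup>2 + 2 * C^3 * c / sqrt (h 0)"
  have k0: "k0 > 0" unfolding k0_def using c c' C h0 by (intro add_pos_pos) auto
  \<comment> \<open>One constant for both conclusions: tracing multiplies \<open>k0\<close> by the
    dimension, and the added 1 covers the Hessian itself and dimension 0.\<close>
  define k where "k = k0 * (real (dim (UNIV :: 'e set)) + 1)"
  have k: "k > 0" "k0 \<le> k" "k0 * real (dim (UNIV :: 'e set)) \<le> k"
    unfolding k_def using k0 by (auto simp: algebra_simps add_pos_nonneg)
  show ?bounds
  proof (intro exI conjI)
    show "k > 0" "c * C > 0" using k c C by auto
    show "outside_compact M (\<lambda>p. \<forall>i \<in> charts_at M p. \<exists>j \<in> charts_at W (\<phi> p).
      \<exists>D. (\<forall>w. D w \<le> c * C * sqrt (\<gamma> p) * tnorm W (\<phi> p) j w) \<and>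
        (\<forall>e. hess M \<gamma> p i e e \<le> k * sqrt (\<gamma> p * h (sqrt (\<gamma> p))) * gcomp M i (coord M i p) e e
          + D (second_fundamental_form M W \<phi> p i j e e)) \<and>
        laplacian M \<gamma> p i \<le> k * sqrt (\<gamma> p * h (sqrt (\<gamma> p))) + D (mean_curvature_vector M W \<phi> p i j))"
    proof (rule outside_compact_mono[OF out], intro ballI)
      fix p i assume p: "p \<in> carr M" and i: "i \<in> charts_at M p"
        and bd: "(\<forall>b \<in> charts_at V (snd (\<phi> p)).
        tnorm V (snd (\<phi> p)) b (grad V \<Gamma> (snd (\<phi> p)) b) \<le> c * sqrt (\<gamma> p)) \<and>
        (\<forall>b \<in> charts_at V (snd (\<phi> p)). \<forall>e. hess V \<Gamma> (snd (\<phi> p)) b e e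
          \<le> c' * sqrt (\<gamma> p * h (sqrt (\<gamma> p))) * gcomp V b (coord V b (snd (\<phi> p))) e e)"
      obtain a b where ab: "warped_immersion_chart X V M \<psi> \<phi> p i a b" "1 / \<psi> (fst (\<phi> p)) \<le> C"
        "\<And>u. \<bar>deriv_at (\<psi> \<circ> chart_inv X a) (coord X a (fst (\<phi> p))) u\<bar> \<le> C * tnorm X (fst (\<phi> p)) a u"
        using charts[OF p i] by blast
      interpret P: warped_immersion_chart X V M \<psi> \<phi> p i a b by (rule ab(1))
      let ?D = "\<lambda>w. P.dfun \<Gamma> (snd w)" and ?r = "sqrt (\<gamma> p * h (sqrt (\<gamma> p)))"
      have cs: "c * sqrt (\<gamma> p) \<ge> 0" using c(1) \<gamma>0[OF p] by simp
      have gb: "tnorm V (snd (\<phi> p)) b (grad V \<Gamma> (snd (\<phi> p)) b) \<le> c * sqrt (\<gamma> p)"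
        using bd P.b by blast
      have hm: "h 0 \<le> h (sqrt (\<gamma> p))"
        using \<gamma>0[OF p] by (intro nondecreasing_on_half_line[OF hs h']) simp
      have r0: "?r \<ge> 0" using hm h0 \<gamma>0[OF p] by simp
      have hb: "hess V \<Gamma> (snd (\<phi> p)) b v v \<le> c' * ?r * gcomp V b (coord V b (snd (\<phi> p))) v v" for v
        using bd P.b by blast
      have "sqrt (\<gamma> p) * sqrt (h 0) \<le> ?r"
        unfolding real_sqrt_mult using hm \<gamma>0[OF p] by (intro mult_left_mono) auto
      then have sr: "sqrt (\<gamma> p) \<le> ?r / sqrt (h 0)" using h0 by (simp add: pos_le_divide_eq)
      have "c' * ?r * C\<^sup>2 + 2 * C^3 * (c * sqrt (\<gamma> p)) \<le> c' * ?r * C\<^sup>2 + 2 * C^3 * (c * (?r / sqrt (h 0)))"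
        using c C by (intro add_left_mono mult_left_mono sr) auto
      also have "\<dots> = k0 * ?r" by (simp add: k0_def algebra_simps)
      finally have coef: "c' * ?r * C\<^sup>2 + 2 * C^3 * (c * sqrt (\<gamma> p)) \<le> k0 * ?r" .
      have g0: "gcomp M i (coord M i p) e e \<ge> 0" for e
        unfolding P.tnorm_sq(1)[symmetric] by simp
      have H: "hess M \<gamma> p i e e \<le> k0 * ?r * gcomp M i (coord M i p) e e
          + ?D (second_fundamental_form M W \<phi> p i (a, b) e e)" for e
        using P.hess_pullback_bound[OF \<Gamma> gb cs hb _ ab(2) _ ab(3), of e] c' r0 C(1)
          mult_right_mono[OF coef g0[of e]] unfolding \<gamma>_def[symmetric] by force
      show "\<exists>j \<in> charts_at W (\<phi> p).
        \<exists>D. (\<forall>w. D w \<le> c * C * sqrt (\<gamma> p) * tnorm W (\<phi> p) j w) \<and>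
        (\<forall>e. hess M \<gamma> p i e e \<le> k * ?r * gcomp M i (coord M i p) e e
          + D (second_fundamental_form M W \<phi> p i j e e)) \<and>
        laplacian M \<gamma> p i \<le> k * ?r + D (mean_curvature_vector M W \<phi> p i j)"
      proof (intro bexI[OF _ P.chart_pair] exI[of _ ?D] conjI allI)
        show "?D w \<le> c * C * sqrt (\<gamma> p) * tnorm W (\<phi> p) (a, b) w" for w
          using P.dfun_bound[OF \<Gamma> gb cs ab(2), of w] by (simp add: mult_ac)
        show "hess M \<gamma> p i e e \<le> k * ?r * gcomp M i (coord M i p) e e
          + ?D (second_fundamental_form M W \<phi> p i (a, b) e e)" for e
          using H[of e] mult_right_mono[OF mult_right_mono[OF k(2) r0] g0[of e]] by linarith
        have "laplacian M \<gamma> p i \<le> k0 * ?r * real (dim (UNIV :: 'e set))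
            + ?D (mean_curvature_vector M W \<phi> p i (a, b))"
          unfolding \<gamma>_def by (rule P.laplacian_pullback_bound[OF \<Gamma> H[unfolded \<gamma>_def]])
        moreover have "k0 * ?r * real (dim (UNIV :: 'e set)) \<le> k * ?r"
          using mult_right_mono[OF k(3) r0] by (simp add: mult_ac)
        ultimately show "laplacian M \<gamma> p i \<le> k * ?r + ?D (mean_curvature_vector M W \<phi> p i (a, b))"
          by linarith
      qed
    qed
  qed
qed

end

theorem theorem3p4:
  fixes X :: "('x, 'i, 'd::real_inner) riem"
    and V :: "('v, 'j, 'f::real_inner) riem"
    and M :: "('m, 'k, 'e::real_inner) riem"
    and \<psi> :: "'x \<Rightarrow> real"
    and \<phi> :: "'m \<Rightarrow> 'x \<times> 'v"
    and h :: "real \<Rightarrow> real"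
    and \<Gamma> :: "'v \<Rightarrow> real"
    and \<gamma> :: "'m \<Rightarrow> real"
    and W :: "('x \<times> 'v, 'i \<times> 'j, 'd \<times> 'f) riem"
  assumes "riemannian_manifold X"
    and "riemannian_manifold V"
    and "riemannian_manifold M"
    and "smooth_function X \<psi>" and "\<forall>p \<in> carr X. \<psi> p > 0"
    and "W = warped_product X \<psi> V"
    and "isometric_immersion M W \<phi>"
    and "OY_pair_hessian V h \<Gamma>"
    and "\<gamma> = \<Gamma> \<circ> snd \<circ> \<phi>"
    and "proper_map (points M) (points W) \<phi>"
    and "\<exists>K. compactin (points X) K \<and> fst ` \<phi> ` carr M \<subseteq> K"
  shows "((\<exists>\<alpha>>0. outside_compact M (\<lambda>p. \<forall>i \<in> charts_at M p. \<forall>j \<in> charts_at W (\<phi> p). \<forall>e.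
             tnorm W (\<phi> p) j (second_fundamental_form M W \<phi> p i j e e)
               \<le> \<alpha> * sqrt (h (sqrt (\<gamma> p))) * (tnorm M p i e)\<^sup>2))
           \<longrightarrow> OY_pair_hessian M h \<gamma>)
       \<and> ((\<exists>\<alpha>>0. outside_compact M (\<lambda>p. \<forall>i \<in> charts_at M p. \<forall>j \<in> charts_at W (\<phi> p).
             tnorm W (\<phi> p) j (mean_curvature_vector M W \<phi> p i j)
               \<le> \<alpha> * sqrt (h (sqrt (\<gamma> p)))))
           \<longrightarrow> OY_pair_laplacian M h \<gamma>)"
proof -
  interpret I: warped_immersion X V M \<psi> \<phi>
    by (rule warped_immersion.intro) (use assms in simp_all)
  obtain K where K: "compactin (points X) K" "fst ` \<phi> ` carr M \<subseteq> K" using assms(11) by blast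
  note pull = I.OY_pullback[OF assms(10)[unfolded assms(6)] K assms(8), folded assms(6,9)]
  have \<gamma>0: "\<gamma> p \<ge> 0" if "p \<in> carr M" for p
    using pull(1) that unfolding OY_common_def by blast
  obtain k l where kl: "k > 0" "l > 0" and out: "outside_compact M (\<lambda>p. \<forall>i \<in> charts_at M p. \<exists>j \<in> charts_at W (\<phi> p).
      \<exists>D. (\<forall>w. D w \<le> l * sqrt (\<gamma> p) * tnorm W (\<phi> p) j w) \<and>
        (\<forall>e. hess M \<gamma> p i e e \<le> k * sqrt (\<gamma> p * h (sqrt (\<gamma> p))) * gcomp M i (coord M i p) e e
          + D (second_fundamental_form M W \<phi> p i j e e)) \<and>
        laplacian M \<gamma> p i \<le> k * sqrt (\<gamma> p * h (sqrt (\<gamma> p))) + D (mean_curvature_vector M W \<phi> p i j))"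
    using pull(2) by blast
  show ?thesis
  proof (intro conjI impI)
    assume "\<exists>\<alpha>>0. outside_compact M (\<lambda>p. \<forall>i \<in> charts_at M p. \<forall>j \<in> charts_at W (\<phi> p). \<forall>e.
             tnorm W (\<phi> p) j (second_fundamental_form M W \<phi> p i j e e)
               \<le> \<alpha> * sqrt (h (sqrt (\<gamma> p))) * (tnorm M p i e)\<^sup>2)"
    then obtain \<alpha> where \<alpha>: "\<alpha> > 0" and S: "outside_compact M (\<lambda>p. \<forall>i \<in> charts_at M p. \<forall>j \<in> charts_at W (\<phi> p). \<forall>e.
             tnorm W (\<phi> p) j (second_fundamental_form M W \<phi> p i j e e)
               \<le> \<alpha> * sqrt (h (sqrt (\<gamma> p))) * (tnorm M p i e)\<^sup>2)" by blast
    \<comment> \<open>By multiplicativity of the square root, \<open>l * sqrt (\<gamma> p)\<close>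
      times the curvature bound is \<open>l * \<alpha>\<close> times the admissible growth, so
      curvature only raises the constant from \<open>k\<close> to
      \<open>k + l * \<alpha>\<close>.\<close>
    have "outside_compact M (\<lambda>p. \<forall>i \<in> charts_at M p. \<forall>e.
        hess M \<gamma> p i e e \<le> (k + l * \<alpha>) * sqrt (\<gamma> p * h (sqrt (\<gamma> p))) * gcomp M i (coord M i p) e e)"
    proof (rule outside_compact_mono[OF outside_compact_conj[OF out S]], intro ballI allI, elim conjE)
      fix p i e
      assume p: "p \<in> carr M" and i: "i \<in> charts_at M p"
        and o: "\<forall>i \<in> charts_at M p. \<exists>j \<in> charts_at W (\<phi> p).
          \<exists>D. (\<forall>w. D w \<le> l * sqrt (\<gamma> p) * tnorm W (\<phi> p) j w) \<and>
          (\<forall>e. hess M \<gamma> p i e e \<le> k * sqrt (\<gamma> p * h (sqrt (\<gamma> p))) * gcomp M i (coord M i p) e e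
            + D (second_fundamental_form M W \<phi> p i j e e)) \<and>
          laplacian M \<gamma> p i \<le> k * sqrt (\<gamma> p * h (sqrt (\<gamma> p))) + D (mean_curvature_vector M W \<phi> p i j)"
        and s: "\<forall>i \<in> charts_at M p. \<forall>j \<in> charts_at W (\<phi> p). \<forall>e.
             tnorm W (\<phi> p) j (second_fundamental_form M W \<phi> p i j e e)
               \<le> \<alpha> * sqrt (h (sqrt (\<gamma> p))) * (tnorm M p i e)\<^sup>2"
      \<comment> \<open>The estimate dictates the chart \<open>j\<close>; the curvature hypothesis
        covers every chart around the image point and so applies in this one.\<close>
      obtain j D where j: "j \<in> charts_at W (\<phi> p)"
        and D: "\<And>w. D w \<le> l * sqrt (\<gamma> p) * tnorm W (\<phi> p) j w"
        and H: "hess M \<gamma> p i e e \<le> k * sqrt (\<gamma> p * h (sqrt (\<gamma> p))) * gcomp M i (coord M i p) e e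
            + D (second_fundamental_form M W \<phi> p i j e e)"
        using o i by blast
      interpret M: riem_chart M i by (rule riem_chartI[OF assms(3) i])
      have "coord M i p \<in> M.img" using i by (simp add: charts_at_def)
      from inner_form.nonneg[OF M.form[OF this]]
      have "(tnorm M p i e)\<^sup>2 = gcomp M i (coord M i p) e e" by (simp add: tnorm_def local_norm_def)
      then have "tnorm W (\<phi> p) j (second_fundamental_form M W \<phi> p i j e e)
          \<le> \<alpha> * sqrt (h (sqrt (\<gamma> p))) * gcomp M i (coord M i p) e e"
        using s i j by metis
      then have "l * sqrt (\<gamma> p) * tnorm W (\<phi> p) j (second_fundamental_form M W \<phi> p i j e e)
          \<le> l * sqrt (\<gamma> p) * (\<alpha> * sqrt (h (sqrt (\<gamma> p))) * gcomp M i (coord M i p) e e)"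
        using kl \<gamma>0[OF p] by (intro mult_left_mono) auto
      with D[of "second_fundamental_form M W \<phi> p i j e e"] H
      show "hess M \<gamma> p i e e \<le> (k + l * \<alpha>) * sqrt (\<gamma> p * h (sqrt (\<gamma> p))) * gcomp M i (coord M i p) e e"
        by (simp add: real_sqrt_mult algebra_simps)
    qed
    then show "OY_pair_hessian M h \<gamma>"
      using pull(1) kl \<alpha> unfolding OY_pair_hessian_def
      by (intro conjI exI[of _ "k + l * \<alpha>"]) (auto intro!: add_pos_pos)
  next
    assume "\<exists>\<alpha>>0. outside_compact M (\<lambda>p. \<forall>i \<in> charts_at M p. \<forall>j \<in> charts_at W (\<phi> p).
             tnorm W (\<phi> p) j (mean_curvature_vector M W \<phi> p i j) \<le> \<alpha> * sqrt (h (sqrt (\<gamma> p))))"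
    then obtain \<alpha> where \<alpha>: "\<alpha> > 0" and S: "outside_compact M (\<lambda>p. \<forall>i \<in> charts_at M p. \<forall>j \<in> charts_at W (\<phi> p).
             tnorm W (\<phi> p) j (mean_curvature_vector M W \<phi> p i j) \<le> \<alpha> * sqrt (h (sqrt (\<gamma> p))))" by blast
    have "outside_compact M (\<lambda>p. \<forall>i \<in> charts_at M p.
        laplacian M \<gamma> p i \<le> (k + l * \<alpha>) * sqrt (\<gamma> p * h (sqrt (\<gamma> p))))"
    proof (rule outside_compact_mono[OF outside_compact_conj[OF out S]], intro ballI, elim conjE)
      fix p i
      assume p: "p \<in> carr M" and i: "i \<in> charts_at M p"
        and o: "\<forall>i \<in> charts_at M p. \<exists>j \<in> charts_at W (\<phi> p).
          \<exists>D. (\<forall>w. D w \<le> l * sqrt (\<gamma> p) * tnorm W (\<phi> p) j w) \<and>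
          (\<forall>e. hess M \<gamma> p i e e \<le> k * sqrt (\<gamma> p * h (sqrt (\<gamma> p))) * gcomp M i (coord M i p) e e
            + D (second_fundamental_form M W \<phi> p i j e e)) \<and>
          laplacian M \<gamma> p i \<le> k * sqrt (\<gamma> p * h (sqrt (\<gamma> p))) + D (mean_curvature_vector M W \<phi> p i j)"
        and s: "\<forall>i \<in> charts_at M p. \<forall>j \<in> charts_at W (\<phi> p).
             tnorm W (\<phi> p) j (mean_curvature_vector M W \<phi> p i j) \<le> \<alpha> * sqrt (h (sqrt (\<gamma> p)))"
      \<comment> \<open>The derivative of \<Gamma> was already moved through the sum over the basis,
        so its bound applies to the mean curvature vector as a whole.\<close>
      obtain j D where j: "j \<in> charts_at W (\<phi> p)"
        and D: "\<And>w. D w \<le> l * sqrt (\<gamma> p) * tnorm W (\<phi> p) j w"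
        and H: "laplacian M \<gamma> p i \<le> k * sqrt (\<gamma> p * h (sqrt (\<gamma> p))) + D (mean_curvature_vector M W \<phi> p i j)"
        using o i by blast
      have "tnorm W (\<phi> p) j (mean_curvature_vector M W \<phi> p i j) \<le> \<alpha> * sqrt (h (sqrt (\<gamma> p)))"
        using s i j by blast
      then have "l * sqrt (\<gamma> p) * tnorm W (\<phi> p) j (mean_curvature_vector M W \<phi> p i j)
          \<le> l * sqrt (\<gamma> p) * (\<alpha> * sqrt (h (sqrt (\<gamma> p))))"
        using kl \<gamma>0[OF p] by (intro mult_left_mono) auto
      with D[of "mean_curvature_vector M W \<phi> p i j"] H
      show "laplacian M \<gamma> p i \<le> (k + l * \<alpha>) * sqrt (\<gamma> p * h (sqrt (\<gamma> p)))"
        by (simp add: real_sqrt_mult algebra_simps)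
    qed
    then show "OY_pair_laplacian M h \<gamma>"
      using pull(1) kl \<alpha> unfolding OY_pair_laplacian_def
      by (intro conjI exI[of _ "k + l * \<alpha>"]) (auto intro!: add_pos_pos)
  qed
qed

end
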